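(* Let $X$ and $Y$ be Banach spaces, $S\in\mathcal{L}(X,Y)$, $F\subset X$ convex and $n\in\mathbb{N}$. Then \[ \Big(\prod_{k=0}^{2n-1} e_k^{\text{det-non}}(S,F)\Big)^{1/(2n)}\;\le\;2^{7/2}\,n^{3/2}\Big(\prod_{k=0}^{n-1} e_k^{\text{ran}}(S,F)\Big)^{1/n}. \] If $F$ is additionally symmetric, or if $Y$ is a Hilbert space, the factor $n^{3/2}$ can be replaced by $n$; if $F$ is symmetric and $Y$ is a Hilbert space, it can be replaced by $n^{1/2}$.
   Context: $\mathcal{L}(X,Y)$ denotes bounded linear operators, $X'$ the dual of $X$. A deterministic adaptive algorithm with $n$ measurements is a map $A_n=\phi\circ N_n\colon F\to Y$ where $\phi\colon\mathbb{R}^n\to Y$ is arbitrary and $N_n(f)=(y_1,\dots,y_n)$ with $y_1=L_1(f)$ and $y_k=L_k^{(y_1,\dots,y_{k-1})}(f)$, where each $L_k^{(\cdot)}\in X'$ may depend arbitrarily on the previously observed values; it is non-adaptive if $L_1,\dots,L_n\in X'$ are fixed. (For $n=0$ the algorithm outputs a constant.) The worst-case error is $e(A_n,S,F)=\sup_{f\in F}\|S(f)-A_n(f)\|_Y$. A randomized algorithm is a family $(A_n^\omega)_{\omega\in\Omega}$ of deterministic adaptive algorithms indexed by a probability space $(\Omega,\mathcal{A},\mathbb{P})$ such that $(f,\omega)\mapsto\|S(f)-A_n^\omega(f)\|_Y$ is $\mathcal{B}_F\otimes\mathcal{A}$-measurable, where $\mathcal{B}_F$ is the Borel $\sigma$-algebra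 on $F$ of the seminorm whose unit ball is $F-F$; its error is $\sup_{f\in F}\mathbb{E}\|S(f)-A_n^\omega(f)\|_Y$. The minimal errors $e_n^{\text{det-non}}(S,F)$ and $e_n^{\text{ran}}(S,F)$ are the infima of the error over all deterministic non-adaptive algorithms, respectively over all randomized (possibly adaptive) algorithms, with $n$ measurements. *)

theory Defs
  imports "HOL-Probability.Probability"
begin

text \<open>Information of a (possibly adaptive) deterministic algorithm with measurement
  maps L: the k-th functional L k ys may depend on the previously observed
  values ys = [y_1,...,y_(k-1)] (0-based: L 0 [] is the first functional).\<close>
fun info :: "(nat \<Rightarrow> real list \<Rightarrow> 'a \<Rightarrow> real) \<Rightarrow> nat \<Rightarrow> 'a \<Rightarrow> real list" where
  "info L 0 f = []"
| "info L (Suc k) f = (let ys = info L k f in ys @ [L k ys f])"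

definition adaptive_info :: "(nat \<Rightarrow> real list \<Rightarrow> 'a::real_normed_vector \<Rightarrow> real) \<Rightarrow> nat \<Rightarrow> bool" where
  "adaptive_info L n \<longleftrightarrow> (\<forall>k<n. \<forall>ys. bounded_linear (L k ys))"

definition wc_error :: "('a \<Rightarrow> 'b::real_normed_vector) \<Rightarrow> 'a set \<Rightarrow> ('a \<Rightarrow> 'b) \<Rightarrow> ennreal" where
  "wc_error S F A = (SUP f\<in>F. ennreal (norm (S f - A f)))"

definition e_det_non :: "('a::real_normed_vector \<Rightarrow> 'b::real_normed_vector) \<Rightarrow> 'a set \<Rightarrow> nat \<Rightarrow> ennreal" where
  "e_det_non S F n = (INF (L, phi) \<in> {(L :: nat \<Rightarrow> 'a \<Rightarrow> real, phi :: real list \<Rightarrow> 'b).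
        \<forall>k<n. bounded_linear (L k)}.
      wc_error S F (\<lambda>f. phi (map (\<lambda>k. L k f) [0..<n])))"

definition gauge_diff :: "'a::real_vector set \<Rightarrow> 'a \<Rightarrow> ennreal" where
  "gauge_diff F x = (INF t \<in> {t::real. t > 0 \<and> x \<in> (\<lambda>z. t *\<^sub>R z) ` {f - g |f g. f \<in> F \<and> g \<in> F}}. ennreal t)"

definition borel_F :: "'a::real_vector set \<Rightarrow> 'a measure" where
  "borel_F F = sigma F {U. U \<subseteq> F \<and> (\<forall>f\<in>U. \<exists>r>0. \<forall>g\<in>F. gauge_diff F (g - f) < ennreal r \<longrightarrow> g \<in> U)}"

definition e_ran :: "'c itself \<Rightarrow> ('a::real_normed_vector \<Rightarrow> 'b::real_normed_vector) \<Rightarrow> 'a set \<Rightarrow> nat \<Rightarrow> ennreal" where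
  "e_ran _ S F n = (INF (M, L, phi) \<in> {(M :: 'c measure, L :: 'c \<Rightarrow> nat \<Rightarrow> real list \<Rightarrow> 'a \<Rightarrow> real,
            phi :: 'c \<Rightarrow> real list \<Rightarrow> 'b).
        prob_space M \<and> (\<forall>\<omega>\<in>space M. adaptive_info (L \<omega>) n) \<and>
        (\<lambda>(f, \<omega>). norm (S f - phi \<omega> (info (L \<omega>) n f))) \<in> borel_measurable (borel_F F \<Otimes>\<^sub>M M)}.
      (SUP f\<in>F. \<integral>\<^sup>+ \<omega>. ennreal (norm (S f - phi \<omega> (info (L \<omega>) n f))) \<partial>M))"

definition hilbert_norm :: "'b::real_normed_vector itself \<Rightarrow> bool" where
  "hilbert_norm _ \<longleftrightarrow> (\<exists>ip :: 'b \<Rightarrow> 'b \<Rightarrow> real.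
      (\<forall>x y. ip x y = ip y x) \<and> (\<forall>x. linear (ip x)) \<and> (\<forall>x. norm x = sqrt (ip x x)))"

definition symmetric_set :: "'a::real_vector set \<Rightarrow> bool" where
  "symmetric_set F \<longleftrightarrow> (\<forall>x\<in>F. - x \<in> F)"

definition eroot :: "nat \<Rightarrow> ennreal \<Rightarrow> ennreal" where
  "eroot m x = (if x = \<top> then \<top> else ennreal (root m (enn2real x)))"

end

theory Submission
  imports Defs "Jordan_Normal_Form.Determinant"
begin

text \<open>
  Write \<open>N = 2n\<close>. Whenever \<open>b\<^sub>k\<close> is below the \<open>k\<close>-th deterministic error for all \<open>k < N\<close>, one chooses
  greedily differences \<open>h\<^sub>k \<in> F - F\<close> and functionals \<open>\<xi>\<^sub>k\<close> of norm one such that the matrix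
  \<open>\<xi>\<^sub>i(S h\<^sub>k)\<close> is lower triangular with \<open>k\<close>-th diagonal entry above \<open>b\<^sub>k\<close>. A ball of \<open>\<real>\<^sup>N\<close> maps
  into \<open>F\<close> along the \<open>h\<^sub>k\<close>, and \<open>y \<mapsto> (\<xi>\<^sub>i y)\<close> maps \<open>Y\<close> boundedly into \<open>\<real>\<^sup>N\<close>, so after scaling
  \<open>S\<close> dominates a matrix whose singular values \<open>\<sigma>\<^sub>0 \<ge> \<sigma>\<^sub>1 \<ge> \<dots>\<close> multiply to its determinant.
  On the span of the first \<open>m = 2k+1\<close> right singular vectors \<open>S\<close> expands distances by at least
  \<open>\<sigma>\<^bsub>2k\<^esub>\<close>. Take there a random input \<open>x\<close> with density proportional to \<open>(1 - |x|\<^sup>2)\<^sup>-\<^sup>1\<^sup>/\<^sup>2\<close> on the unit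
  ball of \<open>\<real>\<^sup>m\<close>, the projection of the uniform distribution on the unit sphere of \<open>\<real>\<^bsup>m+1\<^esup>\<close>. It is
  rotation invariant, and its hyperplane sections are of the same form, so by induction \<open>k\<close> adaptive
  measurements leave an average error of at least \<open>\<sigma>\<^bsub>2k\<^esub> E(x\<^sub>1\<^sup>2 + \<dots> + x\<^bsub>m-k\<^esub>\<^sup>2) = \<sigma>\<^bsub>2k\<^esub> (m-k)/(m+1) = \<sigma>\<^bsub>2k\<^esub>/2\<close>.
  Hence the \<open>k\<close>-th randomized error is at least \<open>\<sigma>\<^bsub>2k\<^esub>/2\<close>, and \<open>\<sigma>\<^bsub>2k+1\<^esub> \<le> \<sigma>\<^bsub>2k\<^esub>\<close> gives the claim.
\<close>

section \<open>Norming functionals\<close>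

definition sublinear :: "('a::real_vector \<Rightarrow> real) \<Rightarrow> bool" where
  "sublinear p \<longleftrightarrow> (\<forall>x y. p (x + y) \<le> p x + p y) \<and> (\<forall>t x. 0 \<le> t \<longrightarrow> p (t *\<^sub>R x) = t * p x)"

lemma
  assumes "sublinear p"
  shows sublinear_add: "p (x + y) \<le> p x + p y"
    and sublinear_scale: "0 \<le> t \<Longrightarrow> p (t *\<^sub>R x) = t * p x"
    and sublinear_0: "p 0 = 0"
    and sublinear_minus_le: "- p (- x) \<le> p x"
proof -
  show add: "p (x + y) \<le> p x + p y" for x y using assms by (simp add: sublinear_def)
  show scale: "0 \<le> t \<Longrightarrow> p (t *\<^sub>R x) = t * p x" for t x using assms by (simp add: sublinear_def)
  show "p 0 = 0" using scale[of 0 0] by simp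
  then show "- p (- x) \<le> p x" using add[of x "- x"] by simp
qed

lemma
  fixes h :: "'i \<Rightarrow> 'a::real_vector \<Rightarrow> real"
  assumes "K \<noteq> {}" and zero: "\<And>k. k \<in> K \<Longrightarrow> h k 0 = 0"
    and add: "\<And>j k a b. j \<in> K \<Longrightarrow> k \<in> K \<Longrightarrow> \<exists>l\<in>K. h l (a + b) \<le> h j a + h k b"
    and scale: "\<And>k t a. k \<in> K \<Longrightarrow> 0 < t \<Longrightarrow> \<exists>l\<in>K. h l (t *\<^sub>R a) \<le> t * h k a"
  shows sublinear_INF: "sublinear (\<lambda>x. INF k\<in>K. h k x)"
    and sublinear_INF_lower: "k \<in> K \<Longrightarrow> (INF k\<in>K. h k x) \<le> h k x"
proof -
  define q where "q x = (INF k\<in>K. h k x)" for x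
  obtain k\<^sub>0 where "k\<^sub>0 \<in> K" using \<open>K \<noteq> {}\<close> by blast
  then have "- h k\<^sub>0 (- x) \<le> h j x" if "j \<in> K" for j x
    using add[OF that, of k\<^sub>0 x "- x"] zero by fastforce
  then have "bdd_below ((\<lambda>k. h k x) ` K)" for x by (rule bdd_belowI2)
  then have lower: "q x \<le> h k x" if "k \<in> K" for k x
    unfolding q_def using that by (intro cINF_lower)
  then show "k \<in> K \<Longrightarrow> (INF k\<in>K. h k x) \<le> h k x" by (simp add: q_def)
  have greatest: "c \<le> q x" if "\<And>k. k \<in> K \<Longrightarrow> c \<le> h k x" for c x
    unfolding q_def using \<open>K \<noteq> {}\<close> that by (intro cINF_greatest)
  have q_add: "q (a + b) \<le> q a + q b" for a b
  proof -
    have "q (a + b) - h j a \<le> h k b" if "j \<in> K" "k \<in> K" for j k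
      using add[OF that, of a b] lower[of _ "a + b"] by fastforce
    then have "q (a + b) - h j a \<le> q b" if "j \<in> K" for j using that by (intro greatest)
    then have "q (a + b) - q b \<le> q a" by (intro greatest) (simp add: algebra_simps)
    then show ?thesis by simp
  qed
  have q_scale_le: "q (t *\<^sub>R a) \<le> t * q a" if "0 < t" for t a
  proof -
    have "q (t *\<^sub>R a) / t \<le> h k a" if "k \<in> K" for k
      using scale[OF that \<open>0 < t\<close>, of a] lower[of _ "t *\<^sub>R a"] \<open>0 < t\<close> by (fastforce simp: field_simps)
    then have "q (t *\<^sub>R a) / t \<le> q a" by (rule greatest)
    then show ?thesis using that by (simp add: field_simps)
  qed
  have q_scale: "q (t *\<^sub>R a) = t * q a" if "0 < t" for t a
    using q_scale_le[OF that, of a] q_scale_le[of "inverse t" "t *\<^sub>R a"] that by (simp add: field_simps)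
  have "q 0 = 0" using \<open>K \<noteq> {}\<close> by (simp add: q_def zero)
  then have "sublinear q"
    using q_add q_scale by (auto simp: sublinear_def le_less)
  then show "sublinear (\<lambda>x. INF k\<in>K. h k x)" by (simp add: q_def[abs_def])
qed

lemma sublinear_minorant_at:
  fixes p :: "'a::real_vector \<Rightarrow> real"
  assumes p: "sublinear p"
  shows "\<exists>q. sublinear q \<and> (\<forall>x. q x \<le> p x) \<and> q (- y) \<le> - p y"
proof -
  define h where "h t x = p (x + t *\<^sub>R y) - t * p y" for t x
  have zero: "h t 0 = 0" if "t \<in> {0..}" for t
    using that by (simp add: h_def sublinear_scale[OF p])
  have add: "\<exists>r\<in>{0..}. h r (a + b) \<le> h s a + h t b" if "s \<in> {0..}" "t \<in> {0..}" for s t a b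
    using that sublinear_add[OF p, of "a + s *\<^sub>R y" "b + t *\<^sub>R y"]
    by (intro bexI[of _ "s + t"]) (auto simp: h_def algebra_simps)
  have scale: "\<exists>r\<in>{0..}. h r (t *\<^sub>R a) \<le> t * h s a" if "s \<in> {0..}" "0 < t" for s t a
    using that sublinear_scale[OF p, of t "a + s *\<^sub>R y"]
    by (intro bexI[of _ "t * s"]) (auto simp: h_def algebra_simps)
  define q where "q x = (INF t\<in>{0..}. h t x)" for x
  have "sublinear q"
    unfolding q_def using zero add scale by (intro sublinear_INF) auto
  moreover have q_le: "q x \<le> h t x" if "0 \<le> t" for t x
    unfolding q_def using zero add scale that by (intro sublinear_INF_lower) auto
  moreover have "q x \<le> p x" for x using q_le[of 0 x] by (simp add: h_def)
  moreover have "q (- y) \<le> - p y" using q_le[of 1 "- y"] by (simp add: h_def sublinear_0[OF p])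
  ultimately show ?thesis by blast
qed

lemma minimal_sublinear_is_linear:
  assumes f: "sublinear f" and minimal: "\<And>q. sublinear q \<Longrightarrow> (\<And>x. q x \<le> f x) \<Longrightarrow> q = f"
  shows "linear f"
proof
  have minus: "f (- x) = - f x" for x
  proof -
    obtain q where q: "sublinear q" "\<And>z. q z \<le> f z" "q (- x) \<le> - f x"
      using sublinear_minorant_at[OF f] by blast
    then have "q = f" by (intro minimal)
    then show ?thesis using q(3) sublinear_minus_le[OF f, of x] by simp
  qed
  show "f (a + b) = f a + f b" for a b
    using sublinear_add[OF f, of a b] sublinear_add[OF f, of "- a" "- b"]
      minus[of "a + b"] minus[of a] minus[of b] by simp
  show "f (r *\<^sub>R a) = r *\<^sub>R f a" for r a
    using sublinear_scale[OF f, of r a] sublinear_scale[OF f, of "- r" a] minus[of "r *\<^sub>R a"]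
    by (cases "0 \<le> r") auto
qed

lemma
  assumes "C \<noteq> {}" and sub: "\<forall>q\<in>C. sublinear q" and chain: "\<forall>q\<in>C. \<forall>r\<in>C. q \<le> r \<or> r \<le> q"
  shows sublinear_INF_chain: "sublinear (\<lambda>x. INF q\<in>C. q x)"
    and sublinear_INF_chain_lower: "q \<in> C \<Longrightarrow> (INF q\<in>C. q x) \<le> q x"
proof -
  have add: "\<exists>l\<in>C. l (a + b) \<le> q a + r b" if qr: "q \<in> C" "r \<in> C" for q r a b
  proof (cases "q \<le> r")
    case True
    then have "q (a + b) \<le> q a + r b"
      using sub qr(1) sublinear_add[of q a b] le_funD[OF True, of b] by auto
    then show ?thesis using qr(1) by blast
  next
    case False
    then have "r \<le> q" using chain qr by blast
    then have "r (a + b) \<le> q a + r b"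
      using sub qr(2) sublinear_add[of r a b] le_funD[of r q a] by auto
    then show ?thesis using qr(2) by blast
  qed
  have zero: "q 0 = 0" if "q \<in> C" for q using sub that by (simp add: sublinear_0)
  have scale: "\<exists>l\<in>C. l (t *\<^sub>R a) \<le> t * q a" if "q \<in> C" "0 < t" for q t a
    using sub that sublinear_scale[of q t a] by (intro bexI[of _ q]) auto
  show "sublinear (\<lambda>x. INF q\<in>C. q x)"
    using \<open>C \<noteq> {}\<close> zero add scale by (intro sublinear_INF[where h = "\<lambda>q. q"]) auto
  show "q \<in> C \<Longrightarrow> (INF q\<in>C. q x) \<le> q x"
    using \<open>C \<noteq> {}\<close> zero add scale by (intro sublinear_INF_lower[where h = "\<lambda>q. q"]) auto
qed

theorem hahn_banach_sublinear:
  fixes p :: "'a::real_vector \<Rightarrow> real"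
  assumes p: "sublinear p"
  shows "\<exists>f. linear f \<and> (\<forall>x. f x \<le> p x)"
proof -
  define A where "A = {q. sublinear q \<and> q \<le> p}"
  have order: "partial_order_on A (relation_of (\<ge>) A)"
    by (rule partial_order_on_relation_ofI) auto
  have "\<exists>u\<in>A. \<forall>q\<in>C. u \<le> q" if C: "C \<in> Chains (relation_of (\<ge>) A)" for C
  proof (cases "C = {}")
    case True
    then show ?thesis using p by (auto simp: A_def)
  next
    case False
    define u where "u x = (INF q\<in>C. q x)" for x
    have C_A: "q \<in> A" if "q \<in> C" for q using C that by (auto simp: Chains_def relation_of_def)
    have sub: "\<forall>q\<in>C. sublinear q" using C_A by (simp add: A_def)
    have chain: "\<forall>q\<in>C. \<forall>r\<in>C. q \<le> r \<or> r \<le> q" using C by (auto simp: Chains_def relation_of_def)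
    have u_le: "u \<le> q" if "q \<in> C" for q
      using sublinear_INF_chain_lower[OF False sub chain that] by (simp add: le_fun_def u_def)
    obtain q where "q \<in> C" using False by blast
    then have "u \<le> p" using u_le[of q] C_A[of q] by (auto simp: A_def)
    moreover have "sublinear u" unfolding u_def by (rule sublinear_INF_chain[OF False sub chain])
    ultimately show ?thesis using u_le by (auto simp: A_def)
  qed
  from predicate_Zorn[OF order this] obtain f where f: "f \<in> A" "\<And>q. q \<in> A \<Longrightarrow> q \<le> f \<Longrightarrow> q = f"
    by blast
  then have "linear f"
    by (intro minimal_sublinear_is_linear) (auto simp: A_def le_fun_def intro: order.trans)
  with f(1) show ?thesis by (auto simp: A_def le_fun_def)
qed

lemma norming_functional_exists:
  fixes y :: "'a::real_normed_vector"
  shows "\<exists>f. bounded_linear f \<and> (\<forall>x. \<bar>f x\<bar> \<le> norm x) \<and> f y = norm y"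
proof -
  have "sublinear (norm :: 'a \<Rightarrow> real)" by (auto simp: sublinear_def norm_triangle_ineq)
  then obtain q where q: "sublinear q" "\<And>x. q x \<le> norm x" "q (- y) \<le> - norm y"
    using sublinear_minorant_at by blast
  then obtain f where f: "linear f" "\<And>x. f x \<le> q x" using hahn_banach_sublinear by blast
  have minus: "f (- x) = - f x" for x using f(1) by (simp add: linear_neg)
  have abs_le: "\<bar>f x\<bar> \<le> norm x" for x
    using f(2)[of x] f(2)[of "- x"] q(2)[of x] q(2)[of "- x"] by (simp add: minus abs_le_iff)
  have "f y = norm y" using abs_le[of y] f(2)[of "- y"] q(3) by (simp add: minus)
  moreover have "bounded_linear f"
    using f(1) abs_le by (auto intro!: bounded_linear_intro[where K = 1] simp: linear_add linear_scale)
  ultimately show ?thesis using abs_le by blast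
qed

section \<open>Singular vectors\<close>

definition dot :: "nat \<Rightarrow> (nat \<Rightarrow> real) \<Rightarrow> (nat \<Rightarrow> real) \<Rightarrow> real" where
  "dot N x y = (\<Sum>i<N. x i * y i)"

definition mat_app :: "nat \<Rightarrow> (nat \<Rightarrow> nat \<Rightarrow> real) \<Rightarrow> (nat \<Rightarrow> real) \<Rightarrow> nat \<Rightarrow> real" where
  "mat_app N T x i = (\<Sum>j<N. T i j * x j)"

definition orthonormal :: "nat \<Rightarrow> (nat \<Rightarrow> nat \<Rightarrow> real) \<Rightarrow> bool" where
  "orthonormal N v \<longleftrightarrow> (\<forall>i<N. \<forall>j<N. dot N (v i) (v j) = (if i = j then 1 else 0))"

definition image_norm :: "nat \<Rightarrow> (nat \<Rightarrow> nat \<Rightarrow> real) \<Rightarrow> (nat \<Rightarrow> real) \<Rightarrow> real" where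
  "image_norm N T x = sqrt (dot N (mat_app N T x) (mat_app N T x))"

definition singular_basis :: "nat \<Rightarrow> (nat \<Rightarrow> nat \<Rightarrow> real) \<Rightarrow> (nat \<Rightarrow> nat \<Rightarrow> real) \<Rightarrow> bool" where
  "singular_basis N T v \<longleftrightarrow> orthonormal N v
    \<and> (\<forall>i<N. \<forall>j<N. i \<noteq> j \<longrightarrow> dot N (mat_app N T (v i)) (mat_app N T (v j)) = 0)
    \<and> (\<forall>i j. i \<le> j \<longrightarrow> j < N \<longrightarrow> image_norm N T (v j) \<le> image_norm N T (v i))"

lemma dot_commute: "dot N x y = dot N y x"
  by (simp add: dot_def mult.commute)

lemma dot_nonneg: "0 \<le> dot N x x"
  by (simp add: dot_def sum_nonneg)

lemma image_norm_nonneg: "0 \<le> image_norm N T x"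
  by (simp add: image_norm_def dot_nonneg)

lemma image_norm_square: "(image_norm N T x)\<^sup>2 = dot N (mat_app N T x) (mat_app N T x)"
  by (simp add: image_norm_def dot_nonneg)

lemma dot_combination_left:
  "dot N (\<lambda>k. a * x k + b * y k) z = a * dot N x z + b * dot N y z"
  by (simp add: dot_def sum.distrib sum_distrib_left algebra_simps)

lemma dot_combination_right:
  "dot N z (\<lambda>k. a * x k + b * y k) = a * dot N z x + b * dot N z y"
  by (simp add: dot_def sum.distrib sum_distrib_left algebra_simps)

lemma mat_app_combination:
  "mat_app N T (\<lambda>k. a * x k + b * y k) = (\<lambda>k. a * mat_app N T x k + b * mat_app N T y k)"
  by (simp add: mat_app_def sum.distrib sum_distrib_left algebra_simps fun_eq_iff)

lemma mat_app_sum: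
  "mat_app N T (\<lambda>k. \<Sum>i\<in>A. x i * v i k) = (\<lambda>k. \<Sum>i\<in>A. x i * mat_app N T (v i) k)"
proof
  fix k
  show "mat_app N T (\<lambda>k. \<Sum>i\<in>A. x i * v i k) k = (\<Sum>i\<in>A. x i * mat_app N T (v i) k)"
    unfolding mat_app_def sum_distrib_left by (subst sum.swap) (simp add: mult.left_commute)
qed

lemma dot_sum_orthogonal:
  assumes "finite A" and orth: "\<And>i j. i \<in> A \<Longrightarrow> j \<in> A \<Longrightarrow> i \<noteq> j \<Longrightarrow> dot N (v i) (v j) = 0"
  shows "dot N (\<lambda>k. \<Sum>i\<in>A. x i * v i k) (\<lambda>k. \<Sum>i\<in>A. x i * v i k) = (\<Sum>i\<in>A. (x i)\<^sup>2 * dot N (v i) (v i))"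
proof -
  have "dot N (\<lambda>k. \<Sum>i\<in>A. x i * v i k) (\<lambda>k. \<Sum>i\<in>A. x i * v i k)
      = (\<Sum>k<N. \<Sum>i\<in>A. \<Sum>j\<in>A. x i * x j * (v i k * v j k))"
    by (simp add: dot_def sum_product mult_ac)
  also have "\<dots> = (\<Sum>i\<in>A. \<Sum>j\<in>A. x i * x j * dot N (v i) (v j))"
    unfolding dot_def sum_distrib_left by (subst sum.swap) (simp add: sum.swap[of _ "{..<N}"])
  also have "\<dots> = (\<Sum>i\<in>A. \<Sum>j\<in>A. if i = j then (x i)\<^sup>2 * dot N (v i) (v i) else 0)"
    using orth by (intro sum.cong) (auto simp: power2_eq_square)
  also have "\<dots> = (\<Sum>i\<in>A. (x i)\<^sup>2 * dot N (v i) (v i))"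
    using \<open>finite A\<close> by (simp add: sum.delta)
  finally show ?thesis .
qed

definition frames :: "nat \<Rightarrow> (nat \<Rightarrow> nat \<Rightarrow> real) set" where
  "frames N = {v. orthonormal N v \<and> (\<forall>i k. N \<le> i \<or> N \<le> k \<longrightarrow> v i k = 0)}"

lemma identity_frame: "(\<lambda>i k. if i = k \<and> i < N then 1 else 0) \<in> frames N"
  by (auto simp: frames_def orthonormal_def dot_def if_distrib[of "\<lambda>z. z * _"] cong: if_cong)

lemma continuous_on_entry [continuous_intros]:
  "continuous_on A (\<lambda>v::nat \<Rightarrow> nat \<Rightarrow> real. v i k)"
  by (rule continuous_on_product_then_coordinatewise[OF
      continuous_on_product_then_coordinatewise[OF continuous_on_id]])

lemma compact_frames: "compact (frames N)"
proof -
  have compact_PiE: "compact (PiE UNIV (\<lambda>_::nat. K))" if "compact K" for K :: "'x::topological_space set"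
    using that compactin_PiE[of "\<lambda>_. euclidean" UNIV "\<lambda>_::nat. K"] by (simp add: euclidean_product_topology)
  define C :: "(nat \<Rightarrow> nat \<Rightarrow> real) set" where "C = PiE UNIV (\<lambda>_. PiE UNIV (\<lambda>_. {-1..1}))"
  have "compact C" unfolding C_def by (intro compact_PiE) simp
  moreover have "closed (frames N)"
  proof -
    have "frames N = (\<Inter>i\<in>{..<N}. \<Inter>j\<in>{..<N}. {v. dot N (v i) (v j) = (if i = j then 1 else 0)})
        \<inter> (\<Inter>(i, k)\<in>{(i, k). N \<le> i \<or> N \<le> k}. {v. v i k = 0})"
      by (auto simp: frames_def orthonormal_def)
    also have "closed \<dots>"
      unfolding dot_def
      by (intro closed_Int closed_INT ballI) (auto intro!: closed_Collect_eq continuous_intros)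
    finally show ?thesis .
  qed
  moreover have "frames N \<subseteq> C"
  proof
    fix v assume v: "v \<in> frames N"
    have "\<bar>v i k\<bar> \<le> 1" for i k
    proof (cases "i < N \<and> k < N")
      case True
      then have "(v i k)\<^sup>2 \<le> (\<Sum>k<N. (v i k)\<^sup>2)" by (intro member_le_sum) auto
      also have "\<dots> = 1" using v True by (simp add: frames_def orthonormal_def dot_def power2_eq_square)
      finally show ?thesis by (simp add: abs_square_le_1)
    next
      case False
      then have "v i k = 0" using v by (auto simp: frames_def not_less)
      then show ?thesis by simp
    qed
    then show "v \<in> C" by (auto simp: C_def abs_le_iff)
  qed
  then have "frames N = C \<inter> frames N" by blast
  ultimately show ?thesis by (metis compact_Int_closed)
qed

lemma frames_rotate_plane:
  assumes v: "v \<in> frames N" and ij: "i < N" "j < N" "i \<noteq> j"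
    and orth: "a\<^sup>2 + b\<^sup>2 = 1" "c\<^sup>2 + d\<^sup>2 = 1" "a * c + b * d = 0"
  shows "v(i := \<lambda>k. a * v i k + b * v j k, j := \<lambda>k. c * v i k + d * v j k) \<in> frames N" (is "?w \<in> _")
proof -
  have "dot N (v l) (v m) = (if l = m then 1 else 0)" if "l < N" "m < N" for l m
    using v that by (simp add: frames_def orthonormal_def)
  then have "orthonormal N ?w"
    using ij orth unfolding orthonormal_def
    by (auto simp: dot_combination_left dot_combination_right power2_eq_square mult.commute)
  moreover have "\<forall>l k. N \<le> l \<or> N \<le> k \<longrightarrow> ?w l k = 0"
    using v ij by (auto simp: frames_def)
  ultimately show ?thesis by (simp add: frames_def)
qed

lemma quadratic_form_minimal_at_axis:
  fixes a b m :: real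
  assumes minimal: "\<And>c s. c\<^sup>2 + s\<^sup>2 = 1 \<Longrightarrow> b \<le> s\<^sup>2 * a - 2 * c * s * m + c\<^sup>2 * b"
  shows "b \<le> a" and "m = 0"
proof -
  show "b \<le> a" using minimal[of 0 1] by simp
  have linear_le_quadratic: "2 * t * m \<le> t\<^sup>2 * (a - b)" for t
  proof -
    define r where "r = sqrt (1 + t\<^sup>2)"
    have r: "r \<noteq> 0" "r\<^sup>2 = 1 + t\<^sup>2" by (simp_all add: r_def add_nonneg_eq_0_iff)
    have "(1 / r)\<^sup>2 + (t / r)\<^sup>2 = 1"
      using r(1) by (simp add: power_divide add_divide_distrib[symmetric] flip: r(2))
    then have "b * r\<^sup>2 \<le> ((t / r)\<^sup>2 * a - 2 * (1 / r) * (t / r) * m + (1 / r)\<^sup>2 * b) * r\<^sup>2"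
      by (intro mult_right_mono minimal) auto
    also have "\<dots> = t\<^sup>2 * a - 2 * t * m + b"
      using r(1) by (simp add: field_simps power2_eq_square)
    finally show ?thesis by (simp add: r(2) algebra_simps)
  qed
  define t where "t = m / (a - b + 1)"
  have m: "m = t * (a - b + 1)" using \<open>b \<le> a\<close> by (simp add: t_def)
  have "t\<^sup>2 * (a - b + 2) \<le> 0" using linear_le_quadratic[of t] by (simp add: m algebra_simps power2_eq_square)
  then have "t = 0" using \<open>b \<le> a\<close> by (simp add: mult_le_0_iff)
  then show "m = 0" by (simp add: m)
qed

lemma sum_fun_upd_two:
  fixes f :: "'i \<Rightarrow> 'v" and g :: "'i \<Rightarrow> 'v \<Rightarrow> 'w::ab_group_add"
  assumes "finite A" "i \<in> A" "j \<in> A" "i \<noteq> j"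
  shows "(\<Sum>l\<in>A. g l ((f(i := x, j := y)) l)) = (\<Sum>l\<in>A. g l (f l)) - g i (f i) - g j (f j) + g i x + g j y"
proof -
  have "(\<Sum>l\<in>A. h l) = (\<Sum>l\<in>A - {i, j}. h l) + (h i + h j)" for h :: "'i \<Rightarrow> 'w"
    using assms sum.subset_diff[of "{i, j}" A h] by simp
  moreover have "(\<Sum>l\<in>A - {i, j}. g l ((f(i := x, j := y)) l)) = (\<Sum>l\<in>A - {i, j}. g l (f l))"
    by (intro sum.cong) auto
  ultimately show ?thesis using \<open>i \<noteq> j\<close> by simp
qed

definition graded_image_energy :: "nat \<Rightarrow> (nat \<Rightarrow> nat \<Rightarrow> real) \<Rightarrow> (nat \<Rightarrow> nat \<Rightarrow> real) \<Rightarrow> real" where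
  "graded_image_energy N T v = (\<Sum>l<N. real l * (image_norm N T (v l))\<^sup>2)"

lemma graded_image_energy_minimizer_exists:
  "\<exists>v\<in>frames N. \<forall>w\<in>frames N. graded_image_energy N T v \<le> graded_image_energy N T w"
proof (rule continuous_attains_inf[OF compact_frames])
  show "frames N \<noteq> {}" using identity_frame by blast
  show "continuous_on (frames N) (graded_image_energy N T)"
    unfolding graded_image_energy_def image_norm_square dot_def mat_app_def by (intro continuous_intros)
qed

text \<open>Rotating in the plane of \<open>v i\<close> and \<open>v j\<close> preserves \<open>|T (v i)|\<^sup>2 + |T (v j)|\<^sup>2\<close>, so minimality of
  the energy puts \<open>v j\<close>, \<open>j > i\<close>, at the minimum of the quadratic form \<open>|T x|\<^sup>2\<close> on the unit circle of that plane.\<close>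

lemma graded_image_energy_minimizer_plane:
  assumes v: "v \<in> frames N" and minimal: "\<forall>w\<in>frames N. graded_image_energy N T v \<le> graded_image_energy N T w"
    and ij: "i < j" "j < N"
  shows "image_norm N T (v j) \<le> image_norm N T (v i)" and "dot N (mat_app N T (v i)) (mat_app N T (v j)) = 0"
proof -
  define q where "q x = (image_norm N T x)\<^sup>2" for x
  define m where "m = dot N (mat_app N T (v i)) (mat_app N T (v j))"
  have q_combination: "q (\<lambda>k. a * v i k + b * v j k) = a\<^sup>2 * q (v i) + 2 * a * b * m + b\<^sup>2 * q (v j)" for a b
    unfolding q_def image_norm_square
    by (simp add: m_def mat_app_combination dot_combination_left dot_combination_right
        dot_commute[of N "mat_app N T (v j)" "mat_app N T (v i)"] power2_eq_square algebra_simps)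
  have q_minimal: "q (v j) \<le> s\<^sup>2 * q (v i) - 2 * c * s * m + c\<^sup>2 * q (v j)" if cs: "c\<^sup>2 + s\<^sup>2 = 1" for c s
  proof -
    let ?x = "\<lambda>k. c * v i k + s * v j k" and ?y = "\<lambda>k. - s * v i k + c * v j k"
    have "q ?x + q ?y = (c\<^sup>2 + s\<^sup>2) * (q (v i) + q (v j))"
      unfolding q_combination by (simp add: algebra_simps)
    then have sum: "q ?x = q (v i) + q (v j) - q ?y" by (simp add: cs)
    have "graded_image_energy N T v \<le> graded_image_energy N T (v(i := ?x, j := ?y))"
      using ij cs by (intro bspec[OF minimal] frames_rotate_plane v) (auto simp: add.commute)
    also have "\<dots> = graded_image_energy N T v - i * q (v i) - j * q (v j) + i * q ?x + j * q ?y"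
      unfolding graded_image_energy_def q_def using ij
      by (intro sum_fun_upd_two[where g = "\<lambda>l x. real l * (image_norm N T x)\<^sup>2"]) auto
    finally have "0 \<le> (real j - real i) * (q ?y - q (v j))"
      unfolding sum by (simp add: algebra_simps)
    then have "q (v j) \<le> q ?y" using ij(1) by (simp add: zero_le_mult_iff)
    then show ?thesis unfolding q_combination by (simp add: algebra_simps)
  qed
  show "image_norm N T (v j) \<le> image_norm N T (v i)"
    using quadratic_form_minimal_at_axis(1)[OF q_minimal]
    by (simp add: q_def abs_le_square_iff[symmetric] image_norm_nonneg)
  show "dot N (mat_app N T (v i)) (mat_app N T (v j)) = 0"
    using quadratic_form_minimal_at_axis(2)[OF q_minimal] by (simp add: m_def)
qed

theorem singular_basis_exists: "\<exists>v. singular_basis N T v"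
proof -
  obtain v where v: "v \<in> frames N" "\<forall>w\<in>frames N. graded_image_energy N T v \<le> graded_image_energy N T w"
    using graded_image_energy_minimizer_exists by blast
  note plane = graded_image_energy_minimizer_plane[OF v]
  have "dot N (mat_app N T (v i)) (mat_app N T (v j)) = 0" if "i < N" "j < N" "i \<noteq> j" for i j
    using that plane(2) by (metis dot_commute linorder_neqE_nat)
  moreover have "image_norm N T (v j) \<le> image_norm N T (v i)" if "i \<le> j" "j < N" for i j
    using that plane(1) by (cases "i = j") auto
  ultimately show ?thesis using v(1) by (auto simp: singular_basis_def frames_def)
qed

lemma prod_image_norm_singular_basis:
  assumes v: "singular_basis N T v"
  shows "(\<Prod>j<N. image_norm N T (v j)) = \<bar>det (mat N N (\<lambda>(i, j). T i j))\<bar>"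
proof -
  define A where "A = mat N N (\<lambda>(i, j). T i j)"
  define V where "V = mat N N (\<lambda>(i, j). v j i)"
  define D where "D = transpose_mat (A * V) * (A * V)"
  have carrier: "A \<in> carrier_mat N N" "V \<in> carrier_mat N N" "A * V \<in> carrier_mat N N" "D \<in> carrier_mat N N"
    by (auto simp: A_def V_def D_def)
  have "transpose_mat V * V = 1\<^sub>m N"
    using v by (intro eq_matI)
      (auto simp: V_def scalar_prod_def singular_basis_def orthonormal_def dot_def atLeast0LessThan)
  then have "det V * det V = 1"
    using carrier by (metis det_mult det_one det_transpose transpose_carrier_mat)
  then have det_D: "det D = (det A)\<^sup>2"
    using carrier by (simp add: D_def det_mult[of _ N] det_transpose[of _ N] power2_eq_square)
  have "(A * V) $$ (i, j) = mat_app N T (v j) i" if "i < N" "j < N" for i j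
    using that by (simp add: A_def V_def scalar_prod_def mat_app_def atLeast0LessThan)
  then have "D $$ (i, j) = dot N (mat_app N T (v i)) (mat_app N T (v j))" if "i < N" "j < N" for i j
    using that carrier by (simp add: D_def scalar_prod_def atLeast0LessThan dot_def)
  then have "det D = (\<Prod>j<N. (image_norm N T (v j))\<^sup>2)"
    using det_lower_triangular[of N D] carrier v
    by (simp add: prod_list_diag_prod atLeast0LessThan image_norm_square singular_basis_def)
  then have "(\<Prod>j<N. image_norm N T (v j))\<^sup>2 = \<bar>det A\<bar>\<^sup>2" by (simp add: det_D prod_power_distrib)
  then have "(\<Prod>j<N. image_norm N T (v j)) = \<bar>det A\<bar>"
    by (rule power2_eq_imp_eq) (auto intro: prod_nonneg image_norm_nonneg)
  then show ?thesis by (simp add: A_def)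
qed

section \<open>A weight on Euclidean balls\<close>

abbreviation lebP :: "'i set \<Rightarrow> ('i \<Rightarrow> real) measure" where
  "lebP I \<equiv> Pi\<^sub>M I (\<lambda>_. lborel)"

interpretation lebP: product_sigma_finite "\<lambda>_::'i. lborel :: real measure"
  by standard

definition sumsq :: "'i set \<Rightarrow> ('i \<Rightarrow> real) \<Rightarrow> real" where
  "sumsq I x = (\<Sum>i\<in>I. (x i)\<^sup>2)"

text \<open>Outside the ball of squared radius \<open>s\<close> the root is negative or zero, so that \<open>ennreal\<close> truncates the
  weight, and likewise the integrand of \<open>half_ball_volume\<close>, to \<open>0\<close>.\<close>

definition ball_weight :: "'i set \<Rightarrow> real \<Rightarrow> ('i \<Rightarrow> real) \<Rightarrow> ennreal" where
  "ball_weight I s x = ennreal (1 / sqrt (s - sumsq I x))"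

definition half_ball_volume :: "'i set \<Rightarrow> real \<Rightarrow> ennreal" where
  "half_ball_volume I s = (\<integral>\<^sup>+x. ennreal (sqrt (s - sumsq I x)) \<partial>lebP I)"

lemma sumsq_nonneg: "0 \<le> sumsq I x"
  by (simp add: sumsq_def sum_nonneg)

lemma sumsq_measurable [measurable]: "sumsq I \<in> borel_measurable (lebP I)"
  unfolding sumsq_def by measurable

lemma ball_weight_measurable [measurable]: "ball_weight I s \<in> borel_measurable (lebP I)"
  unfolding ball_weight_def by measurable

lemma ball_weight_eq_0: "s \<le> sumsq I x \<Longrightarrow> ball_weight I s x = 0"
  by (simp add: ball_weight_def ennreal_neg divide_nonneg_nonpos)

lemma sumsq_insert_upd:
  "finite J \<Longrightarrow> p \<notin> J \<Longrightarrow> sumsq (insert p J) (x(p := y)) = y\<^sup>2 + sumsq J x"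
  unfolding sumsq_def by (subst sum.insert) (auto intro!: sum.cong)

lemma ball_weight_insert_upd:
  "finite J \<Longrightarrow> p \<notin> J \<Longrightarrow> ball_weight (insert p J) s (x(p := y)) = ball_weight J (s - y\<^sup>2) x"
  by (simp add: ball_weight_def sumsq_insert_upd algebra_simps)

lemma half_ball_volume_insert:
  assumes "finite J" "p \<notin> J"
  shows "half_ball_volume (insert p J) s = (\<integral>\<^sup>+y. half_ball_volume J (s - y\<^sup>2) \<partial>lborel)"
  unfolding half_ball_volume_def using assms
  by (subst lebP.product_nn_integral_insert_rev) (auto simp: sumsq_insert_upd algebra_simps)

lemma half_ball_volume_measurable [measurable]:
  assumes "finite I"
  shows "half_ball_volume I \<in> borel_measurable borel"
proof -
  interpret sigma_finite_measure "lebP I" by (rule lebP.sigma_finite[OF assms])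
  show ?thesis unfolding half_ball_volume_def by (rule borel_measurable_nn_integral) measurable
qed

lemma half_ball_volume_mono: "s \<le> t \<Longrightarrow> half_ball_volume I s \<le> half_ball_volume I t"
  unfolding half_ball_volume_def by (intro nn_integral_mono ennreal_leI real_sqrt_le_mono) simp

lemma half_ball_volume_nonpos:
  assumes "s \<le> 0"
  shows "half_ball_volume I s = 0"
proof -
  have "s - sumsq I x \<le> 0" for x using assms sumsq_nonneg[of I x] by linarith
  then show ?thesis by (simp add: half_ball_volume_def ennreal_neg)
qed

lemma half_ball_volume_empty: "half_ball_volume {} s = ennreal (sqrt s)"
  by (simp add: half_ball_volume_def sumsq_def PiM_empty nn_integral_count_space_finite)

lemma half_ball_volume_pos:
  assumes "finite I" "0 < s"
  shows "0 < half_ball_volume I s"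
  using assms
proof (induction I arbitrary: s rule: finite_induct)
  case empty
  then show ?case by (simp add: half_ball_volume_empty)
next
  case (insert p I)
  define r where "r = sqrt (s / 2)"
  have "0 < r" using insert.prems by (simp add: r_def)
  then have "0 < half_ball_volume I (s / 2) * ennreal (2 * r)"
    using insert.IH[of "s / 2"] insert.prems by (simp add: ennreal_zero_less_mult_iff)
  also have "\<dots> = (\<integral>\<^sup>+y. half_ball_volume I (s / 2) * indicator {-r..r} y \<partial>lborel)"
    using \<open>0 < r\<close> by (simp add: nn_integral_cmult_indicator)
  also have "\<dots> \<le> (\<integral>\<^sup>+y. half_ball_volume I (s - y\<^sup>2) \<partial>lborel)"
  proof (rule nn_integral_mono)
    fix y :: real
    have "y\<^sup>2 \<le> s / 2" if "y \<in> {-r..r}" using that by (intro sqrt_ge_absD) (auto simp: r_def)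
    then show "half_ball_volume I (s / 2) * indicator {-r..r} y \<le> half_ball_volume I (s - y\<^sup>2)"
      by (auto simp: indicator_def intro!: half_ball_volume_mono)
  qed
  finally show ?case using insert.hyps by (simp add: half_ball_volume_insert)
qed

lemma half_ball_volume_finite:
  assumes "finite I"
  shows "half_ball_volume I s < \<top>"
  using assms
proof (induction I arbitrary: s rule: finite_induct)
  case empty
  then show ?case by (simp add: half_ball_volume_empty)
next
  case (insert p I)
  define r where "r = sqrt \<bar>s\<bar>"
  have "half_ball_volume (insert p I) s = (\<integral>\<^sup>+y. half_ball_volume I (s - y\<^sup>2) \<partial>lborel)"
    using insert.hyps by (rule half_ball_volume_insert)
  also have "\<dots> \<le> (\<integral>\<^sup>+y. half_ball_volume I s * indicator {-r..r} y \<partial>lborel)"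
  proof (rule nn_integral_mono)
    fix y :: real
    have "s - y\<^sup>2 \<le> 0" if "y \<notin> {-r..r}"
      using that real_le_rsqrt[of y "\<bar>s\<bar>"] real_le_rsqrt[of "- y" "\<bar>s\<bar>"] by (force simp: r_def)
    then show "half_ball_volume I (s - y\<^sup>2) \<le> half_ball_volume I s * indicator {-r..r} y"
      by (cases "y \<in> {-r..r}") (auto intro: half_ball_volume_mono simp: half_ball_volume_nonpos)
  qed
  also have "\<dots> = half_ball_volume I s * ennreal (2 * r)"
    by (simp add: nn_integral_cmult_indicator r_def)
  also have "\<dots> < \<top>" using insert.IH by (simp add: ennreal_mult_less_top)
  finally show ?case .
qed

lemma nn_integral_eq_has_integral_nonneg_part:
  fixes f :: "'a::euclidean_space \<Rightarrow> real"
  assumes "(f has_integral i) A" and nonneg: "\<And>x. x \<in> A \<Longrightarrow> 0 \<le> f x" and nonpos: "\<And>x. x \<notin> A \<Longrightarrow> f x \<le> 0"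
  shows "(\<integral>\<^sup>+x. ennreal (f x) \<partial>lborel) = ennreal i"
proof -
  have "ennreal (f x) = ennreal (f x) * indicator A x" for x
    using nonpos[of x] by (simp add: indicator_def ennreal_neg)
  then show ?thesis using nn_integral_has_integral_lebesgue'[OF nonneg assms(1)] by simp
qed

lemma nn_integral_square_over_sqrt:
  "(\<integral>\<^sup>+y. ennreal (y\<^sup>2 / sqrt (a - y\<^sup>2)) \<partial>lborel) = (\<integral>\<^sup>+y. ennreal (sqrt (a - y\<^sup>2)) \<partial>lborel)"
proof -
  define r where "r = sqrt \<bar>a\<bar>"
  define f g where "f y = sqrt (a - y\<^sup>2)" and "g y = y\<^sup>2 / sqrt (a - y\<^sup>2)" for y
  have outside: "a \<le> y\<^sup>2" if "y \<notin> {-r..r}" for y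
    using that real_le_rsqrt[of y "\<bar>a\<bar>"] real_le_rsqrt[of "- y" "\<bar>a\<bar>"] by (force simp: r_def)
  show ?thesis
  proof (cases "0 < a")
    case False
    then have "a - y\<^sup>2 \<le> 0" for y :: real using zero_le_power2[of y] by linarith
    then show ?thesis by (simp add: ennreal_neg divide_nonneg_nonpos)
  next
    case True
    have inside: "y\<^sup>2 \<le> a" if "y \<in> {-r..r}" for y
      using that True by (intro sqrt_ge_absD) (auto simp: r_def)
    have interior: "y\<^sup>2 < a" if "y \<in> {-r<..<r}" for y
      using that True real_sqrt_le_mono[of a "y\<^sup>2"] by (force simp: r_def)
    have "((\<lambda>y. f y - g y) has_integral r * f r - (-r) * f (-r)) {-r..r}"
    proof (rule fundamental_theorem_of_calculus_interior)
      show "continuous_on {-r..r} (\<lambda>y. y * f y)" unfolding f_def by (intro continuous_intros)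
      show "((\<lambda>y. y * f y) has_vector_derivative f y - g y) (at y)" if "y \<in> {-r<..<r}" for y
        unfolding f_def g_def has_real_derivative_iff_has_vector_derivative[symmetric]
        using interior[OF that] by (auto intro!: derivative_eq_intros simp: field_simps power2_eq_square)
    qed (simp add: r_def)
    then have f_minus_g: "((\<lambda>y. f y - g y) has_integral 0) {-r..r}" using True by (simp add: f_def r_def)
    have f: "(f has_integral integral {-r..r} f) {-r..r}"
      unfolding f_def by (intro integrable_integral integrable_continuous_interval continuous_intros)
    then have g: "(g has_integral integral {-r..r} f) {-r..r}"
      using has_integral_diff[OF f f_minus_g] by simp
    have "(\<integral>\<^sup>+y. ennreal (g y) \<partial>lborel) = ennreal (integral {-r..r} f)"
      using g by (rule nn_integral_eq_has_integral_nonneg_part)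
        (use inside outside in \<open>auto simp: g_def divide_nonneg_nonpos\<close>)
    moreover have "(\<integral>\<^sup>+y. ennreal (f y) \<partial>lborel) = ennreal (integral {-r..r} f)"
      using f by (rule nn_integral_eq_has_integral_nonneg_part)
        (use inside outside in \<open>auto simp: f_def\<close>)
    ultimately show ?thesis by (simp add: f_def g_def)
  qed
qed

lemma ball_weight_second_moment:
  assumes "finite I" "p \<in> I"
  shows "(\<integral>\<^sup>+x. ennreal ((x p)\<^sup>2) * ball_weight I s x \<partial>lebP I) = half_ball_volume I s"
proof -
  define J where "J = I - {p}"
  have J: "finite J" "p \<notin> J" and I: "I = insert p J" using assms by (auto simp: J_def)
  have "(\<integral>\<^sup>+x. ennreal ((x p)\<^sup>2) * ball_weight I s x \<partial>lebP I)
      = (\<integral>\<^sup>+x. \<integral>\<^sup>+y. ennreal (y\<^sup>2) * ball_weight I s (x(p := y)) \<partial>lborel \<partial>lebP J)"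
    unfolding I using J by (subst lebP.product_nn_integral_insert) auto
  also have "\<dots> = (\<integral>\<^sup>+x. \<integral>\<^sup>+y. ennreal (y\<^sup>2 / sqrt (s - sumsq J x - y\<^sup>2)) \<partial>lborel \<partial>lebP J)"
    unfolding I using J by (simp add: ball_weight_def sumsq_insert_upd ennreal_mult'[symmetric] algebra_simps)
  also have "\<dots> = (\<integral>\<^sup>+x. \<integral>\<^sup>+y. ennreal (sqrt (s - sumsq I (x(p := y)))) \<partial>lborel \<partial>lebP J)"
    unfolding nn_integral_square_over_sqrt I using J by (simp add: sumsq_insert_upd algebra_simps)
  also have "\<dots> = half_ball_volume I s"
    unfolding half_ball_volume_def I using J by (subst lebP.product_nn_integral_insert) auto
  finally show ?thesis .
qed

lemma ball_weight_sumsq_moment: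
  assumes "finite I"
  shows "(\<integral>\<^sup>+x. ennreal (sumsq I x) * ball_weight I s x \<partial>lebP I) = ennreal (card I) * half_ball_volume I s"
proof -
  have "(\<integral>\<^sup>+x. ennreal (sumsq I x) * ball_weight I s x \<partial>lebP I)
      = (\<integral>\<^sup>+x. (\<Sum>i\<in>I. ennreal ((x i)\<^sup>2) * ball_weight I s x) \<partial>lebP I)"
    by (simp add: sumsq_def sum_distrib_right[symmetric])
  also have "\<dots> = (\<Sum>i\<in>I. \<integral>\<^sup>+x. ennreal ((x i)\<^sup>2) * ball_weight I s x \<partial>lebP I)"
    by (rule nn_integral_sum) measurable
  also have "\<dots> = ennreal (card I) * half_ball_volume I s"
    using ball_weight_second_moment[OF assms] by (simp add: ennreal_of_nat_eq_real_of_nat)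
  finally show ?thesis .
qed

lemma ball_weight_total:
  assumes "finite I" "0 \<le> s"
  shows "ennreal s * (\<integral>\<^sup>+x. ball_weight I s x \<partial>lebP I) = ennreal (card I + 1) * half_ball_volume I s"
proof -
  have split: "ennreal s * ball_weight I s x
      = ennreal (sqrt (s - sumsq I x)) + ennreal (sumsq I x) * ball_weight I s x" for x
  proof (cases "sumsq I x < s")
    case True
    have "s / sqrt (s - sumsq I x) = ((s - sumsq I x) + sumsq I x) / sqrt (s - sumsq I x)" by simp
    also have "\<dots> = sqrt (s - sumsq I x) + sumsq I x / sqrt (s - sumsq I x)"
      unfolding add_divide_distrib using True by (simp add: real_div_sqrt)
    finally show ?thesis
      using True sumsq_nonneg[of I x] \<open>0 \<le> s\<close>
      by (simp add: ball_weight_def ennreal_mult'[symmetric] ennreal_plus[symmetric] del: ennreal_plus)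
  qed (simp add: ball_weight_eq_0 ennreal_neg)
  have "ennreal s * (\<integral>\<^sup>+x. ball_weight I s x \<partial>lebP I) = (\<integral>\<^sup>+x. ennreal s * ball_weight I s x \<partial>lebP I)"
    by (rule nn_integral_cmult[symmetric]) measurable
  also have "\<dots> = half_ball_volume I s + ennreal (card I) * half_ball_volume I s"
    unfolding split half_ball_volume_def
    by (subst nn_integral_add)
      (use ball_weight_sumsq_moment[OF \<open>finite I\<close>] in \<open>auto simp: half_ball_volume_def\<close>)
  finally show ?thesis by (simp add: distrib_right add.commute)
qed

section \<open>Rotations\<close>

definition volume_preserving :: "'i set \<Rightarrow> (('i \<Rightarrow> real) \<Rightarrow> 'i \<Rightarrow> real) \<Rightarrow> bool" where
  "volume_preserving I U \<longleftrightarrow> U \<in> measurable (lebP I) (lebP I) \<and> distr (lebP I) (lebP I) U = lebP I"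

lemma volume_preservingI:
  assumes [measurable]: "U \<in> measurable (lebP I) (lebP I)"
    and integral: "\<And>g. g \<in> borel_measurable (lebP I) \<Longrightarrow> (\<integral>\<^sup>+x. g (U x) \<partial>lebP I) = (\<integral>\<^sup>+x. g x \<partial>lebP I)"
  shows "volume_preserving I U"
proof -
  have "distr (lebP I) (lebP I) U = lebP I"
  proof (rule measure_eqI)
    fix A assume "A \<in> sets (distr (lebP I) (lebP I) U)"
    then have [measurable]: "A \<in> sets (lebP I)" by simp
    have "emeasure (distr (lebP I) (lebP I) U) A = (\<integral>\<^sup>+x. indicator A x \<partial>distr (lebP I) (lebP I) U)" by simp
    also have "\<dots> = (\<integral>\<^sup>+x. indicator A (U x) \<partial>lebP I)" by (rule nn_integral_distr) auto
    also have "\<dots> = emeasure (lebP I) A" using integral[of "indicator A"] by simp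
    finally show "emeasure (distr (lebP I) (lebP I) U) A = emeasure (lebP I) A" .
  qed simp
  then show ?thesis by (simp add: volume_preserving_def)
qed

lemma nn_integral_volume_preserving:
  assumes "volume_preserving I U" "g \<in> borel_measurable (lebP I)"
  shows "(\<integral>\<^sup>+x. g (U x) \<partial>lebP I) = (\<integral>\<^sup>+x. g x \<partial>lebP I)"
  using assms nn_integral_distr[of U "lebP I" "lebP I" g] by (simp add: volume_preserving_def)

lemma volume_preserving_comp:
  assumes "volume_preserving I U" "volume_preserving I V"
  shows "volume_preserving I (\<lambda>x. U (V x))"
proof -
  have [measurable]: "U \<in> measurable (lebP I) (lebP I)" "V \<in> measurable (lebP I) (lebP I)"
    using assms by (auto simp: volume_preserving_def)
  have "distr (lebP I) (lebP I) (\<lambda>x. U (V x)) = distr (distr (lebP I) (lebP I) V) (lebP I) U"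
    by (subst distr_distr) (auto simp: comp_def)
  then show ?thesis using assms by (simp add: volume_preserving_def)
qed

definition shear :: "'i \<Rightarrow> 'i \<Rightarrow> real \<Rightarrow> ('i \<Rightarrow> real) \<Rightarrow> 'i \<Rightarrow> real" where
  "shear p j t x = x(p := x p + t * x j)"

lemma volume_preserving_shear:
  assumes I: "finite I" "p \<in> I" "j \<in> I" "p \<noteq> j"
  shows "volume_preserving I (shear p j t)"
proof (rule volume_preservingI)
  show shear [measurable]: "shear p j t \<in> measurable (lebP I) (lebP I)"
    unfolding shear_def using I(2,3)
    by (intro measurable_fun_upd[where J = I])
       (auto intro!: borel_measurable_add borel_measurable_times measurable_component_singleton)
  fix g :: "('a \<Rightarrow> real) \<Rightarrow> ennreal" assume g [measurable]: "g \<in> borel_measurable (lebP I)"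
  define J where "J = I - {p}"
  have J: "finite J" "p \<notin> J" and IJ: "insert p J = I" using I by (auto simp: J_def)
  note insert = lebP.product_nn_integral_insert[OF J, unfolded IJ]
  have "(\<integral>\<^sup>+x. g (shear p j t x) \<partial>lebP I) = (\<integral>\<^sup>+x. \<integral>\<^sup>+y. g (shear p j t (x(p := y))) \<partial>lborel \<partial>lebP J)"
    by (rule insert) measurable
  also have "\<dots> = (\<integral>\<^sup>+x. \<integral>\<^sup>+y. g (x(p := t * x j + 1 * y)) \<partial>lborel \<partial>lebP J)"
    using \<open>p \<noteq> j\<close> by (simp add: shear_def add.commute)
  also have "\<dots> = (\<integral>\<^sup>+x. \<integral>\<^sup>+y. g (x(p := y)) \<partial>lborel \<partial>lebP J)"
  proof (rule nn_integral_cong)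
    fix x assume "x \<in> space (lebP J)"
    then have "(\<lambda>y. g (x(p := y))) \<in> borel_measurable borel"
      using measurable_compose[OF measurable_component_update[of x J "\<lambda>_. lborel" p] g[folded IJ]] J(2) by simp
    from nn_integral_real_affine[OF this, of 1 "t * x j"]
    show "(\<integral>\<^sup>+y. g (x(p := t * x j + 1 * y)) \<partial>lborel) = (\<integral>\<^sup>+y. g (x(p := y)) \<partial>lborel)" by simp
  qed
  also have "\<dots> = (\<integral>\<^sup>+x. g x \<partial>lebP I)" by (rule insert[symmetric]) measurable
  finally show "(\<integral>\<^sup>+x. g (shear p j t x) \<partial>lebP I) = (\<integral>\<^sup>+x. g x \<partial>lebP I)" .
qed

definition givens :: "real \<Rightarrow> real \<Rightarrow> 'i \<Rightarrow> 'i \<Rightarrow> ('i \<Rightarrow> real) \<Rightarrow> 'i \<Rightarrow> real" where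
  "givens c s p j x = x(p := c * x p - s * x j, j := s * x p + c * x j)"

lemma givens_eq_shears:
  assumes "p \<noteq> j" "c\<^sup>2 + s\<^sup>2 = 1" "c \<noteq> -1"
  shows "givens c s p j = (\<lambda>x. shear p j (- s / (1 + c)) (shear j p s (shear p j (- s / (1 + c)) x)))"
proof
  fix x :: "'a \<Rightarrow> real"
  define t where "t = s / (1 + c)"
  have "1 + c \<noteq> 0" using assms(3) by (simp add: add_eq_0_iff)
  then have t_c: "t * (1 + c) = s" by (simp add: t_def)
  have "s * s = (1 - c) * (1 + c)" using assms(2) by (simp add: power2_eq_square algebra_simps)
  then have "(t * s) * (1 + c) = (1 - c) * (1 + c)" by (metis t_c mult.assoc mult.commute)
  then have s_t: "s * t = 1 - c" using \<open>1 + c \<noteq> 0\<close> by (simp add: mult.commute)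
  have "x j + s * (x p - t * x j) = s * x p + (1 - s * t) * x j"
    by (simp add: algebra_simps)
  then have "s * x p + c * x j = x j + s * (x p - t * x j)" by (simp add: s_t)
  moreover have "x p - t * x j - t * (s * x p + c * x j) = (1 - s * t) * x p - t * (1 + c) * x j"
    by (simp add: algebra_simps)
  then have "c * x p - s * x j = x p - t * x j - t * (s * x p + c * x j)" by (simp add: s_t t_c)
  ultimately show "givens c s p j x = shear p j (- s / (1 + c)) (shear j p s (shear p j (- s / (1 + c)) x))"
    using assms(1) by (simp add: givens_def shear_def fun_eq_iff flip: t_def)
qed

lemma volume_preserving_givens:
  assumes "finite I" "p \<in> I" "j \<in> I" "p \<noteq> j" "c\<^sup>2 + s\<^sup>2 = 1" "c \<noteq> -1"
  shows "volume_preserving I (givens c s p j)"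
proof -
  have shears: "volume_preserving I (shear p j t)" "volume_preserving I (shear j p t)" for t
    using assms by (auto intro: volume_preserving_shear)
  show ?thesis
    unfolding givens_eq_shears[OF assms(4-6)]
    by (rule volume_preserving_comp[OF shears(1) volume_preserving_comp[OF shears(2,1)]])
qed

lemma volume_preserving_uminus:
  assumes "finite I"
  shows "volume_preserving I (\<lambda>x. \<lambda>i\<in>I. - x i)"
proof -
  let ?neg = "\<lambda>x. \<lambda>i\<in>I. - x i :: real"
  have [measurable]: "?neg \<in> measurable (lebP I) (lebP I)"
    by (intro measurable_restrict) measurable
  have "distr (lebP I) (lebP I) ?neg = lebP I"
  proof (rule lebP.PiM_eqI[OF assms])
    fix A :: "'a \<Rightarrow> real set" assume A: "\<And>i. i \<in> I \<Longrightarrow> A i \<in> sets lborel"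
    then have A_neg: "uminus -` A i \<in> sets lborel" if "i \<in> I" for i
      using that measurable_sets[of uminus borel borel "A i"] by simp
    have "?neg -` Pi\<^sub>E I A \<inter> space (lebP I) = Pi\<^sub>E I (\<lambda>i. uminus -` A i)"
      by (auto simp: space_PiM PiE_iff)
    then have "emeasure (distr (lebP I) (lebP I) ?neg) (Pi\<^sub>E I A) = (\<Prod>i\<in>I. emeasure lborel (uminus -` A i))"
      using A A_neg assms by (subst emeasure_distr) (auto intro!: sets_PiM_I_finite lebP.emeasure_PiM)
    also have "\<dots> = (\<Prod>i\<in>I. emeasure lborel (A i))"
      using A emeasure_distr[of "uminus :: real \<Rightarrow> real" lborel borel]
      by (intro prod.cong) (auto simp: lborel_distr_uminus)
    finally show "emeasure (distr (lebP I) (lebP I) ?neg) (Pi\<^sub>E I A) = (\<Prod>i\<in>I. emeasure lborel (A i))" .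
  qed simp
  then show ?thesis by (simp add: volume_preserving_def)
qed

lemma sumsq_givens:
  assumes "finite I" "p \<in> I" "j \<in> I" "p \<noteq> j" "c\<^sup>2 + s\<^sup>2 = 1"
  shows "sumsq I (givens c s p j x) = sumsq I x"
proof -
  have "(c * x p - s * x j)\<^sup>2 + (s * x p + c * x j)\<^sup>2 = (c\<^sup>2 + s\<^sup>2) * ((x p)\<^sup>2 + (x j)\<^sup>2)"
    by (simp add: algebra_simps power2_eq_square)
  then show ?thesis
    unfolding sumsq_def givens_def sum_fun_upd_two[OF assms(1-4), of "\<lambda>_ z. z\<^sup>2"] by (simp add: assms(5))
qed

lemma sum_scaleR_givens:
  fixes a :: "'i \<Rightarrow> 'v::real_vector"
  assumes "finite I" "p \<in> I" "j \<in> I" "p \<noteq> j"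
  shows "(\<Sum>i\<in>I. givens c s p j x i *\<^sub>R a i)
    = (\<Sum>i\<in>I. x i *\<^sub>R (a(p := c *\<^sub>R a p + s *\<^sub>R a j, j := c *\<^sub>R a j - s *\<^sub>R a p)) i)"
  unfolding givens_def sum_fun_upd_two[OF assms, of "\<lambda>i z. z *\<^sub>R a i"]
    sum_fun_upd_two[OF assms, of "\<lambda>i z. x i *\<^sub>R z"]
  by (simp add: algebra_simps)

lemma rotation_angle_exists:
  fixes a b :: real
  shows "\<exists>c s. c\<^sup>2 + s\<^sup>2 = 1 \<and> 0 \<le> c \<and> c * b = s * a"
proof (cases "a = 0 \<and> b = 0")
  case True
  then show ?thesis by (intro exI[of _ 1] exI[of _ 0]) simp
next
  case False
  define r where "r = (if a < 0 then - sqrt (a\<^sup>2 + b\<^sup>2) else sqrt (a\<^sup>2 + b\<^sup>2))"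
  have "0 < a\<^sup>2 + b\<^sup>2" using False by (simp add: sum_power2_gt_zero_iff)
  then have r: "r\<^sup>2 = a\<^sup>2 + b\<^sup>2" "r \<noteq> 0" by (auto simp: r_def)
  then have "(a / r)\<^sup>2 + (b / r)\<^sup>2 = 1"
    by (simp add: power_divide flip: add_divide_distrib r(1))
  moreover have "0 \<le> a / r" by (cases "a < 0") (auto simp: r_def divide_nonpos_nonneg)
  ultimately show ?thesis by (intro exI[of _ "a / r"] exI[of _ "b / r"]) simp
qed

lemma rotate_functional_to_coordinate:
  fixes a :: "'i \<Rightarrow> 'v::real_vector"
  assumes I: "finite I" "p \<in> I" and l: "linear (l :: 'v \<Rightarrow> real)"
  obtains U a' where "volume_preserving I U" "\<And>x. sumsq I (U x) = sumsq I x"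
    "\<And>x. (\<Sum>i\<in>I. U x i *\<^sub>R a i) = (\<Sum>i\<in>I. x i *\<^sub>R a' i)" "\<And>j. j \<in> I - {p} \<Longrightarrow> l (a' j) = 0"
proof -
  have "\<exists>U a'. volume_preserving I U \<and> (\<forall>x. sumsq I (U x) = sumsq I x)
      \<and> (\<forall>x. (\<Sum>i\<in>I. U x i *\<^sub>R a i) = (\<Sum>i\<in>I. x i *\<^sub>R a' i)) \<and> (\<forall>j\<in>J. l (a' j) = 0)"
    if "finite J" "J \<subseteq> I - {p}" for J
    using that
  proof (induction J rule: finite_induct)
    case empty
    have "volume_preserving I (\<lambda>x. x)" by (simp add: volume_preserving_def)
    then show ?case by (intro exI[of _ "\<lambda>x. x"] exI[of _ a]) simp
  next
    case (insert j J)
    then obtain U a' where U: "volume_preserving I U" "\<And>x. sumsq I (U x) = sumsq I x"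
      and a': "\<And>x. (\<Sum>i\<in>I. U x i *\<^sub>R a i) = (\<Sum>i\<in>I. x i *\<^sub>R a' i)" "\<forall>j\<in>J. l (a' j) = 0" by auto
    have j: "j \<in> I" "p \<noteq> j" "p \<notin> J" using insert.prems by auto
    obtain c s where cs: "c\<^sup>2 + s\<^sup>2 = 1" "0 \<le> c" "c * l (a' j) = s * l (a' p)"
      using rotation_angle_exists by blast
    define b where "b = a'(p := c *\<^sub>R a' p + s *\<^sub>R a' j, j := c *\<^sub>R a' j - s *\<^sub>R a' p)"
    have "volume_preserving I (\<lambda>x. U (givens c s p j x))"
      using I j cs by (intro volume_preserving_comp[OF U(1)] volume_preserving_givens) auto
    moreover have "sumsq I (U (givens c s p j x)) = sumsq I x" for x
      using I j cs by (simp add: U sumsq_givens)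
    moreover have "(\<Sum>i\<in>I. U (givens c s p j x) i *\<^sub>R a i) = (\<Sum>i\<in>I. x i *\<^sub>R b i)" for x
      unfolding a' b_def using I j(1,2) by (rule sum_scaleR_givens)
    moreover have "\<forall>i\<in>insert j J. l (b i) = 0"
      using a'(2) j insert.hyps cs(3) by (auto simp: b_def linear_diff[OF l] linear_scale[OF l])
    ultimately show ?case by (intro exI[of _ "\<lambda>x. U (givens c s p j x)"] exI[of _ b] conjI allI)
  qed
  from this[of "I - {p}"] I(1) show ?thesis using that by blast
qed

section \<open>Average error of adaptive algorithms\<close>

definition affine_chart :: "'i set \<Rightarrow> 'v::real_vector \<Rightarrow> ('i \<Rightarrow> 'v) \<Rightarrow> ('i \<Rightarrow> real) \<Rightarrow> 'v" where
  "affine_chart I c a x = c + (\<Sum>i\<in>I. x i *\<^sub>R a i)"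

definition output_error ::
    "('v \<Rightarrow> 'w::real_normed_vector) \<Rightarrow> (nat \<Rightarrow> real list \<Rightarrow> 'v \<Rightarrow> real) \<Rightarrow> (real list \<Rightarrow> 'w) \<Rightarrow> nat \<Rightarrow> 'v \<Rightarrow> real" where
  "output_error S L \<phi> k f = norm (S f - \<phi> (info L k f))"

definition expands_by :: "real \<Rightarrow> ('v::real_vector \<Rightarrow> 'w::real_normed_vector) \<Rightarrow> 'i set \<Rightarrow> ('i \<Rightarrow> 'v) \<Rightarrow> bool" where
  "expands_by \<delta> S I a \<longleftrightarrow> (\<forall>x. \<delta> * sqrt (sumsq I x) \<le> norm (S (\<Sum>i\<in>I. x i *\<^sub>R a i)))"

lemma affine_chart_insert_upd:
  assumes "finite J" "p \<notin> J"
  shows "affine_chart (insert p J) c a (x(p := y)) = affine_chart J (c + y *\<^sub>R a p) a x"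
proof -
  have "(\<Sum>i\<in>J. (x(p := y)) i *\<^sub>R a i) = (\<Sum>i\<in>J. x i *\<^sub>R a i)"
    using assms by (intro sum.cong) auto
  then show ?thesis using assms by (simp add: affine_chart_def add.assoc)
qed

lemma linear_affine_chart:
  assumes "linear l"
  shows "l (affine_chart I c a x) = l c + (\<Sum>i\<in>I. x i *\<^sub>R l (a i))"
  by (simp add: affine_chart_def linear_add[OF assms] linear_sum[OF assms] linear_scale[OF assms])

lemma expands_by_rotated:
  assumes "expands_by \<delta> S I a" "\<And>x. sumsq I (U x) = sumsq I x"
    and "\<And>x. (\<Sum>i\<in>I. U x i *\<^sub>R a i) = (\<Sum>i\<in>I. x i *\<^sub>R a' i)"
  shows "expands_by \<delta> S I a'"
  unfolding expands_by_def
proof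
  fix x
  show "\<delta> * sqrt (sumsq I x) \<le> norm (S (\<Sum>i\<in>I. x i *\<^sub>R a' i))"
    using assms(1)[unfolded expands_by_def, rule_format, of "U x"] by (simp add: assms(2,3))
qed

lemma expands_by_subset:
  fixes I J :: "'i set"
  assumes "finite I" "J \<subseteq> I" "expands_by \<delta> S I a"
  shows "expands_by \<delta> S J a"
  unfolding expands_by_def
proof
  fix x :: "'i \<Rightarrow> real"
  define z where "z i = (if i \<in> J then x i else 0)" for i
  have "sumsq I z = sumsq J x"
    unfolding sumsq_def using assms(1,2) by (intro sum.mono_neutral_cong_right) (auto simp: z_def)
  moreover have "(\<Sum>i\<in>I. z i *\<^sub>R a i) = (\<Sum>i\<in>J. x i *\<^sub>R a i)"
    using assms(1,2) by (intro sum.mono_neutral_cong_right) (auto simp: z_def)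
  ultimately show "\<delta> * sqrt (sumsq J x) \<le> norm (S (\<Sum>i\<in>J. x i *\<^sub>R a i))"
    using assms(3) unfolding expands_by_def by metis
qed

lemma info_Cons: "info L (Suc n) f = L 0 [] f # info (\<lambda>k ys. L (Suc k) (L 0 [] f # ys)) n f"
proof (induction n)
  case (Suc n)
  have "info L (Suc (Suc n)) f = (let ys = info L (Suc n) f in ys @ [L (Suc n) ys f])"
    by (simp only: info.simps(2)[of L "Suc n"])
  then show ?case unfolding Suc by (simp add: Let_def)
qed simp

lemma weighted_average_lower_of_symmetrization:
  assumes I: "finite I" and "s \<le> 1" "0 \<le> \<delta>" and [measurable]: "g \<in> borel_measurable (lebP I)"
    and sym: "\<And>x. x \<in> space (lebP I) \<Longrightarrow> sumsq I x < s \<Longrightarrow>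
      ennreal (2 * (\<delta> * sqrt (sumsq I x))) \<le> g x + g (\<lambda>i\<in>I. - x i)"
  shows "ennreal (\<delta> * card I) * half_ball_volume I s \<le> (\<integral>\<^sup>+x. g x * ball_weight I s x \<partial>lebP I)"
proof -
  let ?neg = "\<lambda>x. \<lambda>i\<in>I. - x i :: real"
  have vp: "volume_preserving I ?neg" by (rule volume_preserving_uminus[OF I])
  then have [measurable]: "(\<lambda>x. g (?neg x)) \<in> borel_measurable (lebP I)"
    by (auto simp: volume_preserving_def intro: measurable_compose)
  have pointwise: "ennreal (2 * \<delta>) * (ennreal (sumsq I x) * ball_weight I s x)
      \<le> g x * ball_weight I s x + g (?neg x) * ball_weight I s (?neg x)" if x: "x \<in> space (lebP I)" for x
  proof (cases "sumsq I x < s")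
    case True
    have "sumsq I x * sumsq I x \<le> 1 * sumsq I x"
      using True \<open>s \<le> 1\<close> sumsq_nonneg[of I x] by (intro mult_right_mono) auto
    then have "sumsq I x \<le> sqrt (sumsq I x)"
      by (intro real_le_rsqrt) (simp add: power2_eq_square)
    then have "ennreal (2 * (\<delta> * sumsq I x)) \<le> g x + g (?neg x)"
      using \<open>0 \<le> \<delta>\<close> by (intro order.trans[OF ennreal_leI sym[OF x True]] mult_left_mono) auto
    then have "ennreal (2 * (\<delta> * sumsq I x)) * ball_weight I s x \<le> (g x + g (?neg x)) * ball_weight I s x"
      by (rule mult_right_mono) simp
    moreover have "ball_weight I s (?neg x) = ball_weight I s x" by (simp add: ball_weight_def sumsq_def)
    ultimately show ?thesis
      using \<open>0 \<le> \<delta>\<close> sumsq_nonneg[of I x] by (simp add: ennreal_mult distrib_right mult.assoc)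
  qed (simp add: ball_weight_eq_0)
  have "ennreal 2 * (ennreal (\<delta> * card I) * half_ball_volume I s)
      = ennreal (2 * \<delta>) * (\<integral>\<^sup>+x. ennreal (sumsq I x) * ball_weight I s x \<partial>lebP I)"
    using \<open>0 \<le> \<delta>\<close> by (simp add: ball_weight_sumsq_moment[OF I] ennreal_mult mult.assoc)
  also have "\<dots> = (\<integral>\<^sup>+x. ennreal (2 * \<delta>) * (ennreal (sumsq I x) * ball_weight I s x) \<partial>lebP I)"
    by (rule nn_integral_cmult[symmetric]) measurable
  also have "\<dots> \<le> (\<integral>\<^sup>+x. g x * ball_weight I s x + g (?neg x) * ball_weight I s (?neg x) \<partial>lebP I)"
    by (intro nn_integral_mono pointwise)
  also have "\<dots> = (\<integral>\<^sup>+x. g x * ball_weight I s x \<partial>lebP I)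
      + (\<integral>\<^sup>+x. g (?neg x) * ball_weight I s (?neg x) \<partial>lebP I)"
    using vp by (intro nn_integral_add) (auto simp: volume_preserving_def)
  also have "\<dots> = ennreal 2 * (\<integral>\<^sup>+x. g x * ball_weight I s x \<partial>lebP I)"
    using nn_integral_volume_preserving[OF vp, of "\<lambda>x. g x * ball_weight I s x"] by (simp add: mult_2)
  finally show ?thesis by (subst (asm) ennreal_mult_le_mult_iff) auto
qed

lemma constant_output_average_error_lower:
  fixes S :: "'v::real_vector \<Rightarrow> 'w::real_normed_vector"
  assumes "finite I" "s \<le> 1" "0 \<le> \<delta>" and S: "linear S" and expands: "expands_by \<delta> S I a"
    and "g \<in> borel_measurable (lebP I)"
    and error: "\<And>x. x \<in> space (lebP I) \<Longrightarrow> sumsq I x < s \<Longrightarrow> ennreal (norm (S (affine_chart I c a x) - b)) \<le> g x"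
  shows "ennreal (\<delta> * card I) * half_ball_volume I s \<le> (\<integral>\<^sup>+x. g x * ball_weight I s x \<partial>lebP I)"
proof (rule weighted_average_lower_of_symmetrization)
  fix x assume x: "x \<in> space (lebP I)" "sumsq I x < s"
  define x' where "x' = (\<lambda>i\<in>I. - x i)"
  define z where "z = S c - b"
  define v where "v = S (\<Sum>i\<in>I. x i *\<^sub>R a i)"
  have "S (affine_chart I c a x) - b = z + v"
    by (simp add: affine_chart_def linear_add[OF S] z_def v_def)
  moreover have "(\<Sum>i\<in>I. x' i *\<^sub>R a i) = - (\<Sum>i\<in>I. x i *\<^sub>R a i)" by (simp add: x'_def sum_negf)
  then have "S (affine_chart I c a x') - b = z - v"
    by (simp add: affine_chart_def linear_diff[OF S] z_def v_def)
  moreover have "x' \<in> space (lebP I)" "sumsq I x' < s" using x by (simp_all add: x'_def space_PiM sumsq_def)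
  ultimately have error_reflected: "ennreal (norm (z + v)) \<le> g x" "ennreal (norm (z - v)) \<le> g x'"
    using error[of x] error[of x'] x by simp_all
  have "2 * (\<delta> * sqrt (sumsq I x)) \<le> 2 * norm v"
    using expands by (simp add: expands_by_def v_def)
  also have "\<dots> = norm ((z + v) - (z - v))" by (simp flip: scaleR_2)
  also have "\<dots> \<le> norm (z + v) + norm (z - v)" by (rule norm_triangle_ineq4)
  finally have "ennreal (2 * (\<delta> * sqrt (sumsq I x))) \<le> ennreal (norm (z + v)) + ennreal (norm (z - v))"
    by (simp add: ennreal_leI flip: ennreal_plus)
  also have "\<dots> \<le> g x + g x'" using error_reflected by (rule add_mono)
  finally show "ennreal (2 * (\<delta> * sqrt (sumsq I x))) \<le> g x + g (\<lambda>i\<in>I. - x i)" by (simp add: x'_def)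
qed fact+

lemma nn_integral_ball_weight_rotate:
  assumes U: "volume_preserving I U" "\<And>x. sumsq I (U x) = sumsq I x" and g: "g \<in> borel_measurable (lebP I)"
  shows "(\<integral>\<^sup>+x. g (U x) * ball_weight I s x \<partial>lebP I) = (\<integral>\<^sup>+x. g x * ball_weight I s x \<partial>lebP I)"
proof -
  have "(\<integral>\<^sup>+x. g (U x) * ball_weight I s x \<partial>lebP I) = (\<integral>\<^sup>+x. g (U x) * ball_weight I s (U x) \<partial>lebP I)"
    by (simp add: ball_weight_def U(2))
  also have "\<dots> = (\<integral>\<^sup>+x. g x * ball_weight I s x \<partial>lebP I)"
    using g by (intro nn_integral_volume_preserving[OF U(1)]) simp
  finally show ?thesis .
qed

lemma nn_integral_ball_weight_slices:
  assumes "finite J" "p \<notin> J" "g \<in> borel_measurable (lebP (insert p J))"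
  shows "(\<integral>\<^sup>+x. g x * ball_weight (insert p J) s x \<partial>lebP (insert p J))
    = (\<integral>\<^sup>+y. \<integral>\<^sup>+x. g (x(p := y)) * ball_weight J (s - y\<^sup>2) x \<partial>lebP J \<partial>lborel)"
  using assms by (subst lebP.product_nn_integral_insert_rev) (auto simp: ball_weight_insert_upd)

lemma info_affine_chart_slice:
  assumes "linear (L 0 [])" "\<And>i. i \<in> I \<Longrightarrow> L 0 [] (a i) = 0"
  shows "info L (Suc k) (affine_chart I c a x)
    = L 0 [] c # info (\<lambda>j ys. L (Suc j) (L 0 [] c # ys)) k (affine_chart I c a x)"
proof -
  have "L 0 [] (affine_chart I c a x) = L 0 [] c"
    using assms(2) by (simp add: linear_affine_chart[OF assms(1)])
  then show ?thesis by (simp only: info_Cons)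
qed

lemma adaptive_average_error_slices:
  assumes J: "finite J" "p \<notin> J" and first: "linear (L 0 [])" "\<And>j. j \<in> J \<Longrightarrow> L 0 [] (a j) = 0"
    and g: "g \<in> borel_measurable (lebP (insert p J))"
    and error: "\<And>x. x \<in> space (lebP (insert p J)) \<Longrightarrow> sumsq (insert p J) x < s \<Longrightarrow>
      ennreal (output_error S L \<phi> (Suc k) (affine_chart (insert p J) c a x)) \<le> g x"
    and slice: "\<And>y t h. y = L 0 [] (c + t *\<^sub>R a p) \<Longrightarrow> h \<in> borel_measurable (lebP J) \<Longrightarrow>
      (\<And>x. x \<in> space (lebP J) \<Longrightarrow> sumsq J x < s - t\<^sup>2 \<Longrightarrow>
        ennreal (output_error S (\<lambda>j ys. L (Suc j) (y # ys)) (\<lambda>ys. \<phi> (y # ys)) k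
          (affine_chart J (c + t *\<^sub>R a p) a x)) \<le> h x) \<Longrightarrow>
      C * half_ball_volume J (s - t\<^sup>2) \<le> (\<integral>\<^sup>+x. h x * ball_weight J (s - t\<^sup>2) x \<partial>lebP J)"
  shows "C * half_ball_volume (insert p J) s \<le> (\<integral>\<^sup>+x. g x * ball_weight (insert p J) s x \<partial>lebP (insert p J))"
proof -
  have "C * half_ball_volume J (s - t\<^sup>2) \<le> (\<integral>\<^sup>+x. g (x(p := t)) * ball_weight J (s - t\<^sup>2) x \<partial>lebP J)" for t
  proof (rule slice[OF refl])
    show "(\<lambda>x. g (x(p := t))) \<in> borel_measurable (lebP J)"
      by (rule measurable_compose[OF _ g], rule measurable_fun_upd[where J = J]) auto
    fix x assume x: "x \<in> space (lebP J)" "sumsq J x < s - t\<^sup>2"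
    define y where "y = L 0 [] (c + t *\<^sub>R a p)"
    have "x(p := t) \<in> space (lebP (insert p J))" "sumsq (insert p J) (x(p := t)) < s"
      using x by (auto simp: sumsq_insert_upd[OF J] space_PiM PiE_def extensional_def)
    from error[OF this]
    have "ennreal (output_error S L \<phi> (Suc k) (affine_chart J (c + t *\<^sub>R a p) a x)) \<le> g (x(p := t))"
      by (simp only: affine_chart_insert_upd[OF J])
    then show "ennreal (output_error S (\<lambda>j ys. L (Suc j) (y # ys)) (\<lambda>ys. \<phi> (y # ys)) k
        (affine_chart J (c + t *\<^sub>R a p) a x)) \<le> g (x(p := t))"
      by (simp only: output_error_def info_affine_chart_slice[where L = L, OF first] y_def)
  qed
  then have "(\<integral>\<^sup>+t. C * half_ball_volume J (s - t\<^sup>2) \<partial>lborel)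
      \<le> (\<integral>\<^sup>+t. \<integral>\<^sup>+x. g (x(p := t)) * ball_weight J (s - t\<^sup>2) x \<partial>lebP J \<partial>lborel)"
    by (rule nn_integral_mono)
  then show ?thesis
    using J g by (simp add: half_ball_volume_insert nn_integral_cmult nn_integral_ball_weight_slices)
qed

text \<open>The functionals may depend non-measurably on the observed values. Tonelli is therefore applied only
  to the measurable majorant \<open>g\<close> of the error, after rotating the first functional into a coordinate.\<close>

lemma adaptive_average_error_lower:
  fixes S :: "'v::real_vector \<Rightarrow> 'w::real_normed_vector" and I :: "'i set"
  assumes "finite I" "s \<le> 1" "0 \<le> \<delta>" "linear S" "expands_by \<delta> S I a"
    and "\<And>j ys. j < k \<Longrightarrow> linear (L j ys :: 'v \<Rightarrow> real)"
    and "g \<in> borel_measurable (lebP I)"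
    and "\<And>x. x \<in> space (lebP I) \<Longrightarrow> sumsq I x < s \<Longrightarrow> ennreal (output_error S L \<phi> k (affine_chart I c a x)) \<le> g x"
  shows "ennreal (\<delta> * real (card I - k)) * half_ball_volume I s \<le> (\<integral>\<^sup>+x. g x * ball_weight I s x \<partial>lebP I)"
  using assms
proof (induction k arbitrary: I s L c a \<phi> g)
  case 0
  from constant_output_average_error_lower[OF "0.prems"(1-5,7), of c "\<phi> []"] "0.prems"(8)
  show ?case by (simp add: output_error_def)
next
  case (Suc k)
  note I = Suc.prems(1) and linear_L = Suc.prems(6) and g = Suc.prems(7) and error = Suc.prems(8)
  show ?case
  proof (cases "I = {}")
    case False
    then obtain p where p: "p \<in> I" by blast
    have first: "linear (L 0 [])" by (rule linear_L) simp
    obtain U a' where U: "volume_preserving I U" "\<And>x. sumsq I (U x) = sumsq I x"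
      "\<And>x. (\<Sum>i\<in>I. U x i *\<^sub>R a i) = (\<Sum>i\<in>I. x i *\<^sub>R a' i)" and a': "\<And>j. j \<in> I - {p} \<Longrightarrow> L 0 [] (a' j) = 0"
      using rotate_functional_to_coordinate[OF I p first] by blast
    have U_meas: "U \<in> measurable (lebP I) (lebP I)" using U(1) by (simp add: volume_preserving_def)
    define J where "J = I - {p}"
    have J: "finite J" "p \<notin> J" and IJ: "I = insert p J" using I p by (auto simp: J_def)
    have expands: "expands_by \<delta> S J a'"
      using expands_by_subset[OF I _ expands_by_rotated[OF Suc.prems(5) U(2,3)], of J] by (auto simp: J_def)
    have "ennreal (\<delta> * real (card I - Suc k)) * half_ball_volume I s
        \<le> (\<integral>\<^sup>+x. g (U x) * ball_weight I s x \<partial>lebP I)"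
      unfolding IJ
    proof (rule adaptive_average_error_slices[where L = L and a = a' and c = c and S = S and \<phi> = \<phi>, OF J first])
      show "L 0 [] (a' j) = 0" if "j \<in> J" for j using a' that by (simp add: J_def)
      show "(\<lambda>x. g (U x)) \<in> borel_measurable (lebP (insert p J))"
        using measurable_compose[OF U_meas g] by (simp add: IJ)
      show "ennreal (output_error S L \<phi> (Suc k) (affine_chart (insert p J) c a' x)) \<le> g (U x)"
        if "x \<in> space (lebP (insert p J))" "sumsq (insert p J) x < s" for x
        using error[OF measurable_space[OF U_meas], of x] that by (simp add: affine_chart_def U(2,3) flip: IJ)
      fix y t h
      assume h: "h \<in> borel_measurable (lebP J)" "\<And>x. x \<in> space (lebP J) \<Longrightarrow> sumsq J x < s - t\<^sup>2 \<Longrightarrow>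
        ennreal (output_error S (\<lambda>j ys. L (Suc j) (y # ys)) (\<lambda>ys. \<phi> (y # ys)) k
          (affine_chart J (c + t *\<^sub>R a' p) a' x)) \<le> h x"
      have "s - t\<^sup>2 \<le> 1" using Suc.prems(2) zero_le_power2[of t] by linarith
      from Suc.IH[OF J(1) this Suc.prems(3,4) expands linear_L h]
      show "ennreal (\<delta> * real (card (insert p J) - Suc k)) * half_ball_volume J (s - t\<^sup>2)
          \<le> (\<integral>\<^sup>+x. h x * ball_weight J (s - t\<^sup>2) x \<partial>lebP J)"
        using J by simp
    qed
    also have "\<dots> = (\<integral>\<^sup>+x. g x * ball_weight I s x \<partial>lebP I)"
      by (rule nn_integral_ball_weight_rotate[OF U(1,2) g])
    finally show ?thesis .
  qed simp
qed

section \<open>Lower bounds for randomized errors\<close>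

lemma gauge_diff_affine_chart_less:
  assumes ball: "\<And>x. sumsq I x < 1 \<Longrightarrow> affine_chart I c a x \<in> F"
    and "sumsq I (\<lambda>i. x i - z i) < r\<^sup>2" "0 < r"
  shows "gauge_diff F (affine_chart I c a x - affine_chart I c a z) < ennreal r"
proof -
  define d where "d = sqrt (sumsq I (\<lambda>i. x i - z i))"
  have d: "0 \<le> d" "d < r" "d\<^sup>2 = sumsq I (\<lambda>i. x i - z i)"
    using assms(2,3) sumsq_nonneg[of I "\<lambda>i. x i - z i"] by (auto simp: d_def intro!: real_less_lsqrt)
  obtain t where t: "d < t" "t < r" using dense[OF d(2)] by blast
  define u where "u i = (x i - z i) / t" for i
  have "sumsq I u = d\<^sup>2 / t\<^sup>2"
    unfolding d(3) by (simp add: sumsq_def u_def power_divide sum_divide_distrib)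
  also have "\<dots> < 1" using d(1) t by (simp add: power_strict_mono)
  finally have "affine_chart I c a u \<in> F" by (rule ball)
  moreover have "affine_chart I c a (\<lambda>_. 0) \<in> F" by (rule ball) (simp add: sumsq_def)
  moreover have "affine_chart I c a x - affine_chart I c a z
      = t *\<^sub>R (affine_chart I c a u - affine_chart I c a (\<lambda>_. 0))"
    using d(1) t(1) by (simp add: affine_chart_def u_def scaleR_sum_right flip: sum_subtractf scaleR_diff_left)
  ultimately have "affine_chart I c a x - affine_chart I c a z \<in> (\<lambda>z. t *\<^sub>R z) ` {f - g |f g. f \<in> F \<and> g \<in> F}"
    by blast
  then have "gauge_diff F (affine_chart I c a x - affine_chart I c a z) \<le> ennreal t"
    unfolding gauge_diff_def using d(1) t(1) by (intro INF_lower) auto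
  also have "\<dots> < ennreal r" using d(1) t by (simp add: ennreal_lessI)
  finally show ?thesis .
qed

lemma identity_measurable_lebP: "(\<lambda>x. x) \<in> measurable (lebP (I :: 'i::countable set)) borel"
proof (rule measurable_coordinatewise_then_product)
  fix i
  show "(\<lambda>x. x i) \<in> borel_measurable (lebP I)"
  proof (cases "i \<in> I")
    case False
    then have "(\<lambda>x. x i) \<in> borel_measurable (lebP I) \<longleftrightarrow> (\<lambda>x. undefined :: real) \<in> borel_measurable (lebP I)"
      by (intro measurable_cong) (auto simp: space_PiM PiE_def extensional_def)
    then show ?thesis by simp
  qed measurable
qed

definition clip :: "'i set \<Rightarrow> ('i \<Rightarrow> real) \<Rightarrow> 'i \<Rightarrow> real" where
  "clip I x = (if sumsq I x < 1 then x else (\<lambda>_. 0))"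

lemma sumsq_clip: "sumsq I (clip I x) < 1"
  by (simp add: clip_def sumsq_def)

lemma open_sumsq_less: "open {x :: 'i \<Rightarrow> real. sumsq I (\<lambda>i. x i - z i) < r}"
  unfolding sumsq_def by (intro open_Collect_less continuous_intros) auto

lemma affine_chart_clip_measurable:
  fixes I :: "'i::countable set"
  assumes ball: "\<And>x. sumsq I x < 1 \<Longrightarrow> affine_chart I c a x \<in> F"
  shows "(\<lambda>x. affine_chart I c a (clip I x)) \<in> measurable (lebP I) (borel_F F)"
  unfolding borel_F_def
proof (rule measurable_measure_of)
  show "(\<lambda>x. affine_chart I c a (clip I x)) \<in> space (lebP I) \<rightarrow> F"
    using ball sumsq_clip by blast
  fix U assume "U \<in> {U. U \<subseteq> F \<and> (\<forall>f\<in>U. \<exists>r>0. \<forall>g\<in>F. gauge_diff F (g - f) < ennreal r \<longrightarrow> g \<in> U)}"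
  then have U: "\<And>f. f \<in> U \<Longrightarrow> \<exists>r>0. \<forall>g\<in>F. gauge_diff F (g - f) < ennreal r \<longrightarrow> g \<in> U" by blast
  define P where "P = {x. sumsq I x < 1 \<and> affine_chart I c a x \<in> U}"
  have "open P"
  proof (subst open_subopen, intro ballI)
    fix z assume "z \<in> P"
    then obtain r where r: "0 < r" "\<And>g. g \<in> F \<Longrightarrow> gauge_diff F (g - affine_chart I c a z) < ennreal r \<Longrightarrow> g \<in> U"
      using U[of "affine_chart I c a z"] by (auto simp: P_def)
    define T where "T = {x. sumsq I x < 1} \<inter> {x. sumsq I (\<lambda>i. x i - z i) < r\<^sup>2}"
    have "open T" unfolding T_def using open_sumsq_less[of I "\<lambda>_. 0"] by (auto intro: open_sumsq_less)
    moreover have "z \<in> T" using \<open>z \<in> P\<close> r(1) by (simp add: T_def P_def) (simp add: sumsq_def)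
    moreover have "T \<subseteq> P"
      using r ball gauge_diff_affine_chart_less[OF ball] by (fastforce simp: T_def P_def)
    ultimately show "\<exists>T. open T \<and> z \<in> T \<and> T \<subseteq> P" by blast
  qed
  then have [measurable]: "Measurable.pred (lebP I) (\<lambda>x. x \<in> P)"
    using measurable_sets[OF identity_measurable_lebP, of P I]
    by (simp add: pred_def vimage_def Int_def conj_commute)
  have "(\<lambda>x. affine_chart I c a (clip I x)) -` U \<inter> space (lebP I)
      = {x \<in> space (lebP I). x \<in> P \<or> \<not> sumsq I x < 1 \<and> affine_chart I c a (\<lambda>_. 0) \<in> U}"
    by (auto simp: clip_def P_def split: if_splits)
  also have "\<dots> \<in> sets (lebP I)" by measurable
  finally show "(\<lambda>x. affine_chart I c a (clip I x)) -` U \<inter> space (lebP I) \<in> sets (lebP I)" .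
qed blast

lemma average_case_lower_bound:
  fixes S :: "'a::real_normed_vector \<Rightarrow> 'b::real_normed_vector" and Q :: "'q measure"
  assumes Q: "0 < emeasure Q (space Q)" "emeasure Q (space Q) < \<top>"
    and h: "h \<in> measurable Q (borel_F F)" "h ` space Q \<subseteq> F"
    and average: "\<And>L \<phi>. adaptive_info L k \<Longrightarrow> (\<lambda>x. output_error S L \<phi> k (h x)) \<in> borel_measurable Q \<Longrightarrow>
      b * emeasure Q (space Q) \<le> (\<integral>\<^sup>+x. ennreal (output_error S L \<phi> k (h x)) \<partial>Q)"
  shows "b \<le> e_ran TYPE('c) S F k"
  unfolding e_ran_def
proof (rule INF_greatest, clarify)
  fix M :: "'c measure" and L :: "'c \<Rightarrow> nat \<Rightarrow> real list \<Rightarrow> 'a \<Rightarrow> real" and \<phi> :: "'c \<Rightarrow> real list \<Rightarrow> 'b"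
  assume M: "prob_space M" and L: "\<forall>\<omega>\<in>space M. adaptive_info (L \<omega>) k"
    and meas: "(\<lambda>(f, \<omega>). norm (S f - \<phi> \<omega> (info (L \<omega>) k f))) \<in> borel_measurable (borel_F F \<Otimes>\<^sub>M M)"
  interpret M: prob_space M by (rule M)
  interpret Q: finite_measure Q using Q(2) by (intro finite_measureI) simp
  interpret pair_sigma_finite Q M ..
  define err where "err f \<omega> = output_error S (L \<omega>) (\<phi> \<omega>) k f" for f \<omega>
  define E where "E = (SUP f\<in>F. \<integral>\<^sup>+\<omega>. ennreal (err f \<omega>) \<partial>M)"
  have "(\<lambda>(x, \<omega>). (h x, \<omega>)) \<in> measurable (Q \<Otimes>\<^sub>M M) (borel_F F \<Otimes>\<^sub>M M)"
    unfolding split_beta by (intro measurable_Pair measurable_compose[OF measurable_fst h(1)] measurable_snd)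
  from measurable_compose[OF this meas]
  have err_meas [measurable]: "(\<lambda>(x, \<omega>). err (h x) \<omega>) \<in> borel_measurable (Q \<Otimes>\<^sub>M M)"
    by (simp add: err_def output_error_def split_beta)
  have "b * emeasure Q (space Q) = (\<integral>\<^sup>+\<omega>. b * emeasure Q (space Q) \<partial>M)"
    by (simp add: M.emeasure_space_1)
  also have "\<dots> \<le> (\<integral>\<^sup>+\<omega>. \<integral>\<^sup>+x. ennreal (err (h x) \<omega>) \<partial>Q \<partial>M)"
  proof (rule nn_integral_mono)
    fix \<omega> assume \<omega>: "\<omega> \<in> space M"
    then have "(\<lambda>x. err (h x) \<omega>) \<in> borel_measurable Q" by measurable
    then show "b * emeasure Q (space Q) \<le> (\<integral>\<^sup>+x. ennreal (err (h x) \<omega>) \<partial>Q)"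
      using L \<omega> average[of "L \<omega>" "\<phi> \<omega>"] by (simp add: err_def)
  qed
  also have "\<dots> = (\<integral>\<^sup>+x. \<integral>\<^sup>+\<omega>. ennreal (err (h x) \<omega>) \<partial>M \<partial>Q)"
    by (rule Fubini') measurable
  also have "\<dots> \<le> (\<integral>\<^sup>+x. E \<partial>Q)"
    unfolding E_def using h(2) by (intro nn_integral_mono SUP_upper) auto
  also have "\<dots> = E * emeasure Q (space Q)" by simp
  finally have "emeasure Q (space Q) * b \<le> emeasure Q (space Q) * E" by (simp add: mult.commute)
  then have "b \<le> E" using Q by (simp add: ennreal_mult_le_mult_iff)
  then show "b \<le> (SUP f\<in>F. \<integral>\<^sup>+\<omega>. ennreal (norm (S f - \<phi> \<omega> (info (L \<omega>) k f))) \<partial>M)"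
    by (simp add: E_def err_def output_error_def)
qed

definition ball_measure :: "'i set \<Rightarrow> ('i \<Rightarrow> real) measure" where
  "ball_measure I = density (lebP I) (ball_weight I 1)"

lemma measurable_ball_measure [simp]: "measurable (ball_measure I) M = measurable (lebP I) M"
  by (intro measurable_cong_sets) (simp_all add: ball_measure_def)

lemma nn_integral_ball_measure:
  assumes "g \<in> borel_measurable (lebP I)"
  shows "(\<integral>\<^sup>+x. g x \<partial>ball_measure I) = (\<integral>\<^sup>+x. g x * ball_weight I 1 x \<partial>lebP I)"
  unfolding ball_measure_def using assms by (subst nn_integral_density) (auto simp: mult.commute)

lemma emeasure_ball_measure:
  assumes "finite I"
  shows "emeasure (ball_measure I) (space (ball_measure I)) = ennreal (card I + 1) * half_ball_volume I 1"
  using nn_integral_ball_measure[of "\<lambda>_. 1" I] ball_weight_total[OF assms, of 1] by (simp del: ennreal_plus)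

theorem e_ran_lower_bound:
  fixes S :: "'a::real_normed_vector \<Rightarrow> 'b::real_normed_vector" and I :: "'i::countable set"
  assumes S: "linear S" and I: "finite I" and "0 \<le> \<delta>" and expands: "expands_by \<delta> S I a"
    and ball: "\<And>x. sumsq I x < 1 \<Longrightarrow> affine_chart I c a x \<in> F"
  shows "ennreal (\<delta> * real (card I - k) / real (card I + 1)) \<le> e_ran TYPE('c) S F k"
proof (rule average_case_lower_bound)
  let ?Q = "ball_measure I"
  define h where "h x = affine_chart I c a (clip I x)" for x
  note mass = emeasure_ball_measure[OF I]
  show "0 < emeasure ?Q (space ?Q)" "emeasure ?Q (space ?Q) < \<top>"
    using half_ball_volume_pos[OF I, of 1] half_ball_volume_finite[OF I, of 1]
    by (auto simp: mass ennreal_zero_less_mult_iff ennreal_mult_less_top simp del: ennreal_plus)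
  show "h \<in> measurable ?Q (borel_F F)"
    using affine_chart_clip_measurable[OF ball] by (simp add: h_def[abs_def])
  show "h ` space ?Q \<subseteq> F" using ball sumsq_clip by (auto simp: h_def)
  fix L :: "nat \<Rightarrow> real list \<Rightarrow> 'a \<Rightarrow> real" and \<phi> :: "real list \<Rightarrow> 'b"
  assume L: "adaptive_info L k" and meas: "(\<lambda>x. output_error S L \<phi> k (h x)) \<in> borel_measurable ?Q"
  define g where "g x = ennreal (output_error S L \<phi> k (h x))" for x
  have g: "g \<in> borel_measurable (lebP I)" using meas unfolding g_def by simp
  have linear_L: "linear (L j ys)" if "j < k" for j ys
    using L that by (auto simp: adaptive_info_def dest: bounded_linear.linear)
  have g_ball: "ennreal (output_error S L \<phi> k (affine_chart I c a x)) \<le> g x" if "sumsq I x < 1" for x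
    using that by (simp add: g_def h_def clip_def)
  have "ennreal (\<delta> * real (card I - k) / real (card I + 1)) * emeasure ?Q (space ?Q)
      = ennreal (\<delta> * real (card I - k)) * half_ball_volume I 1"
    unfolding mass using \<open>0 \<le> \<delta>\<close>
    by (simp add: ennreal_mult[symmetric] mult.assoc[symmetric] add_nonneg_eq_0_iff del: ennreal_plus)
  also have "\<dots> \<le> (\<integral>\<^sup>+x. g x * ball_weight I 1 x \<partial>lebP I)"
    by (rule adaptive_average_error_lower[OF I order_refl \<open>0 \<le> \<delta>\<close> S expands linear_L g g_ball])
  also have "\<dots> = (\<integral>\<^sup>+x. g x \<partial>?Q)" by (rule nn_integral_ball_measure[OF g, symmetric])
  finally show "ennreal (\<delta> * real (card I - k) / real (card I + 1)) * emeasure ?Q (space ?Q)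
      \<le> (\<integral>\<^sup>+x. ennreal (output_error S L \<phi> k (h x)) \<partial>?Q)" by (simp add: g_def)
qed

lemma sum_scaleR_combination:
  fixes a :: "'j \<Rightarrow> 'v::real_vector"
  shows "(\<Sum>i\<in>I. x i *\<^sub>R (\<Sum>l\<in>J. v i l *\<^sub>R a l)) = (\<Sum>l\<in>J. (\<Sum>i\<in>I. x i * v i l) *\<^sub>R a l)"
  unfolding scaleR_sum_left scaleR_sum_right by (subst sum.swap) simp

lemma expands_by_singular_vectors:
  fixes S :: "'a::real_normed_vector \<Rightarrow> 'b::real_normed_vector" and \<xi> :: "nat \<Rightarrow> 'b \<Rightarrow> real"
  defines "A \<equiv> \<lambda>a i j. \<xi> i (S (a j :: 'a))"
  assumes S: "linear S" and \<xi>: "\<And>i. i < N \<Longrightarrow> linear (\<xi> i)"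
    and bessel: "\<And>y. (\<Sum>i<N. (\<xi> i y)\<^sup>2) \<le> \<beta>\<^sup>2 * (norm y)\<^sup>2" and "0 < \<beta>"
    and v: "singular_basis N (A a) v" and m: "m < N"
  shows "expands_by (image_norm N (A a) (v m) / \<beta>) S {..m} (\<lambda>i. \<Sum>l<N. v i l *\<^sub>R a l)"
  unfolding expands_by_def
proof
  fix x :: "nat \<Rightarrow> real"
  define T where "T = mat_app N (A a)"
  define \<sigma> where "\<sigma> i = image_norm N (A a) (v i)" for i
  define w where "w l = (\<Sum>i\<le>m. x i * v i l)" for l
  define y where "y = S (\<Sum>i\<le>m. x i *\<^sub>R (\<Sum>l<N. v i l *\<^sub>R a l))"
  have \<sigma>_nonneg: "0 \<le> \<sigma> i" for i by (simp add: \<sigma>_def image_norm_nonneg)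
  have \<sigma>_antimono: "\<sigma> m \<le> \<sigma> i" if "i \<le> m" for i
    using v m that by (simp add: singular_basis_def \<sigma>_def)
  have \<xi>_y: "\<xi> i y = T w i" if "i < N" for i
    by (simp add: y_def w_def sum_scaleR_combination T_def A_def mat_app_def linear_sum[OF S] linear_scale[OF S]
        linear_sum[OF \<xi>[OF that]] linear_scale[OF \<xi>[OF that]] mult.commute)
  have "(\<sigma> m)\<^sup>2 * sumsq {..m} x \<le> (\<Sum>i\<le>m. (x i)\<^sup>2 * (\<sigma> i)\<^sup>2)"
    unfolding sumsq_def sum_distrib_left mult.commute[of "(\<sigma> m)\<^sup>2"]
    by (intro sum_mono mult_left_mono power_mono \<sigma>_antimono \<sigma>_nonneg) auto
  also have "\<dots> = dot N (T w) (T w)"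
    using dot_sum_orthogonal[of "{..m}" N "\<lambda>i. T (v i)" x] v m
    by (simp add: T_def w_def[abs_def] mat_app_sum \<sigma>_def image_norm_square singular_basis_def)
  also have "\<dots> = (\<Sum>i<N. (\<xi> i y)\<^sup>2)" using \<xi>_y by (simp add: dot_def power2_eq_square)
  also have "\<dots> \<le> (\<beta> * norm y)\<^sup>2" using bessel[of y] by (simp add: power_mult_distrib)
  finally have "sqrt ((\<sigma> m)\<^sup>2 * sumsq {..m} x) \<le> sqrt ((\<beta> * norm y)\<^sup>2)"
    by (rule real_sqrt_le_mono)
  then show "\<sigma> m / \<beta> * sqrt (sumsq {..m} x) \<le> norm y"
    using \<open>0 < \<beta>\<close> \<sigma>_nonneg by (simp add: real_sqrt_mult field_simps)
qed

lemma e_ran_ge_singular_value: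
  fixes S :: "'a::real_normed_vector \<Rightarrow> 'b::real_normed_vector" and \<xi> :: "nat \<Rightarrow> 'b \<Rightarrow> real"
  defines "A \<equiv> \<lambda>a i j. \<xi> i (S (a j :: 'a))"
  assumes S: "linear S" and \<xi>: "\<And>i. i < N \<Longrightarrow> linear (\<xi> i)"
    and bessel: "\<And>y. (\<Sum>i<N. (\<xi> i y)\<^sup>2) \<le> \<beta>\<^sup>2 * (norm y)\<^sup>2" and "0 < \<beta>"
    and ball: "\<And>x. sumsq {..<N} x \<le> 1 \<Longrightarrow> affine_chart {..<N} c a x \<in> F"
    and v: "singular_basis N (A a) v" and m: "m < N"
  shows "ennreal (image_norm N (A a) (v m) / \<beta> * real (Suc m - k) / real (m + 2)) \<le> e_ran TYPE('c) S F k"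
proof -
  define b where "b i = (\<Sum>l<N. v i l *\<^sub>R a l)" for i
  have "affine_chart {..m} c b x \<in> F" if "sumsq {..m} x < 1" for x
  proof -
    define w where "w l = (\<Sum>i\<le>m. x i * v i l)" for l
    have "sumsq {..<N} w = sumsq {..m} x"
      using dot_sum_orthogonal[of "{..m}" N v x] v m
      by (simp add: w_def sumsq_def dot_def power2_eq_square singular_basis_def orthonormal_def)
    then show ?thesis
      using ball[of w] that by (simp add: affine_chart_def b_def w_def sum_scaleR_combination)
  qed
  moreover have "expands_by (image_norm N (A a) (v m) / \<beta>) S {..m} b"
    unfolding b_def A_def by (rule expands_by_singular_vectors[OF S \<xi> bessel \<open>0 < \<beta>\<close> v[unfolded A_def] m])
  moreover have "0 \<le> image_norm N (A a) (v m) / \<beta>" using \<open>0 < \<beta>\<close> image_norm_nonneg by simp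
  ultimately show ?thesis
    using e_ran_lower_bound[OF S, of "{..m}" "image_norm N (A a) (v m) / \<beta>" b c F k] by simp
qed

lemma prod_le_square_of_even_factors:
  fixes \<sigma> :: "nat \<Rightarrow> real"
  assumes "\<And>j. j < 2 * n \<Longrightarrow> 0 \<le> \<sigma> j" "\<And>k. k < n \<Longrightarrow> \<sigma> (Suc (2 * k)) \<le> \<sigma> (2 * k)"
  shows "(\<Prod>j<2 * n. \<sigma> j) \<le> (\<Prod>k<n. \<sigma> (2 * k))\<^sup>2"
  using assms
proof (induction n)
  case (Suc n)
  have "(\<Prod>j<2 * Suc n. \<sigma> j) = (\<Prod>j<2 * n. \<sigma> j) * (\<sigma> (2 * n) * \<sigma> (Suc (2 * n)))"
    by (simp add: mult.assoc)
  also have "\<dots> \<le> (\<Prod>k<n. \<sigma> (2 * k))\<^sup>2 * (\<sigma> (2 * n) * \<sigma> (2 * n))"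
    using Suc.prems by (intro mult_mono Suc.IH mult_left_mono) auto
  also have "\<dots> = (\<Prod>k<Suc n. \<sigma> (2 * k))\<^sup>2" by (simp add: power2_eq_square mult_ac)
  finally show ?case .
qed simp

lemma square_prod_le_square_prod_ennreal:
  assumes "0 \<le> C" "\<And>k. k < n \<Longrightarrow> 0 \<le> \<sigma> k" "\<And>k. k < n \<Longrightarrow> ennreal (\<sigma> k) \<le> ennreal C * e k"
  shows "ennreal ((\<Prod>k<n. \<sigma> k)\<^sup>2) \<le> ennreal (C ^ (2 * n)) * (\<Prod>k<n. e k)\<^sup>2"
proof -
  have nonneg: "0 \<le> (\<Prod>k<n. \<sigma> k)" using assms(2) by (intro prod_nonneg) simp
  have "ennreal (\<Prod>k<n. \<sigma> k) = (\<Prod>k<n. ennreal (\<sigma> k))"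
    using assms(2) by (intro prod_ennreal[symmetric]) simp
  also have "\<dots> \<le> (\<Prod>k<n. ennreal C * e k)"
    using assms(3) by (intro prod_mono_ennreal) simp
  also have "\<dots> = ennreal (C ^ n) * (\<Prod>k<n. e k)"
    using \<open>0 \<le> C\<close> by (simp add: prod.distrib ennreal_power)
  finally have "(ennreal (\<Prod>k<n. \<sigma> k))\<^sup>2 \<le> (ennreal (C ^ n) * (\<Prod>k<n. e k))\<^sup>2"
    by (intro power_mono) auto
  moreover have "(ennreal (\<Prod>k<n. \<sigma> k))\<^sup>2 = ennreal ((\<Prod>k<n. \<sigma> k)\<^sup>2)"
    using nonneg by (rule ennreal_power)
  moreover have "(ennreal (C ^ n))\<^sup>2 = ennreal (C ^ (2 * n))"
    using \<open>0 \<le> C\<close> by (simp add: ennreal_power power_even_eq)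
  ultimately show ?thesis by (simp add: power_mult_distrib)
qed

lemma triangular_diagonal_le_e_ran:
  fixes S :: "'a::real_normed_vector \<Rightarrow> 'b::real_normed_vector"
  assumes S: "linear S" and \<xi>: "\<And>i. i < 2 * n \<Longrightarrow> linear (\<xi> i :: 'b \<Rightarrow> real)"
    and bessel: "\<And>y. (\<Sum>i<2 * n. (\<xi> i y)\<^sup>2) \<le> \<beta>\<^sup>2 * (norm y)\<^sup>2" and "0 < \<beta>"
    and ball: "\<And>x. sumsq {..<2 * n} x \<le> 1 \<Longrightarrow> affine_chart {..<2 * n} c a x \<in> F"
    and triangular: "\<And>i j. i < j \<Longrightarrow> j < 2 * n \<Longrightarrow> \<xi> i (S (a j)) = 0"
  shows "ennreal (\<Prod>j<2 * n. \<xi> j (S (a j))) \<le> ennreal ((2 * \<beta>) ^ (2 * n)) * (\<Prod>k<n. e_ran TYPE('c) S F k)\<^sup>2"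
proof -
  define A where "A i j = \<xi> i (S (a j))" for i j
  obtain v where v: "singular_basis (2 * n) A v" using singular_basis_exists by blast
  define \<sigma> where "\<sigma> j = image_norm (2 * n) A (v j)" for j
  have \<sigma>_nonneg: "0 \<le> \<sigma> j" for j by (simp add: \<sigma>_def image_norm_nonneg)
  have \<sigma>_antimono: "\<sigma> (Suc (2 * k)) \<le> \<sigma> (2 * k)" if "k < n" for k
    using v that by (simp add: \<sigma>_def singular_basis_def)
  have "(\<Prod>j<2 * n. A j j) = det (mat (2 * n) (2 * n) (\<lambda>(i, j). A i j))"
    using det_lower_triangular[of "2 * n" "mat (2 * n) (2 * n) (\<lambda>(i, j). A i j)"] triangular
    by (simp add: A_def prod_list_diag_prod atLeast0LessThan)
  also have "\<dots> \<le> (\<Prod>j<2 * n. \<sigma> j)"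
    unfolding \<sigma>_def prod_image_norm_singular_basis[OF v] by (rule abs_ge_self)
  also have "\<dots> \<le> (\<Prod>k<n. \<sigma> (2 * k))\<^sup>2"
    by (intro prod_le_square_of_even_factors \<sigma>_nonneg \<sigma>_antimono)
  finally have "ennreal (\<Prod>j<2 * n. A j j) \<le> ennreal ((\<Prod>k<n. \<sigma> (2 * k))\<^sup>2)" by (rule ennreal_leI)
  also have "\<dots> \<le> ennreal ((2 * \<beta>) ^ (2 * n)) * (\<Prod>k<n. e_ran TYPE('c) S F k)\<^sup>2"
  proof (rule square_prod_le_square_prod_ennreal)
    fix k assume k: "k < n"
    have "real (Suc (2 * k) - k) / real (2 * k + 2) = 1 / 2" by (simp add: field_simps)
    then have "\<sigma> (2 * k) / \<beta> * real (Suc (2 * k) - k) / real (2 * k + 2) = \<sigma> (2 * k) / (2 * \<beta>)"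
      by (simp only: times_divide_eq_right[symmetric]) simp
    then have "ennreal (\<sigma> (2 * k) / (2 * \<beta>)) \<le> e_ran TYPE('c) S F k"
      using e_ran_ge_singular_value[OF S \<xi> bessel \<open>0 < \<beta>\<close> ball v[unfolded A_def], of "2 * k" k] k
      by (simp add: \<sigma>_def A_def[abs_def])
    then have "ennreal (2 * \<beta>) * ennreal (\<sigma> (2 * k) / (2 * \<beta>)) \<le> ennreal (2 * \<beta>) * e_ran TYPE('c) S F k"
      by (rule mult_left_mono) simp
    then show "ennreal (\<sigma> (2 * k)) \<le> ennreal (2 * \<beta>) * e_ran TYPE('c) S F k"
      using \<open>0 < \<beta>\<close> \<sigma>_nonneg by (simp add: ennreal_mult[symmetric])
  qed (use \<open>0 < \<beta>\<close> \<sigma>_nonneg in simp_all)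
  finally show ?thesis by (simp add: A_def)
qed

section \<open>Comparison of the error products\<close>

lemma e_det_non_witness:
  fixes S :: "'a::real_normed_vector \<Rightarrow> 'b::real_normed_vector" and L :: "nat \<Rightarrow> 'a \<Rightarrow> real"
  assumes "b < e_det_non S F k" and L: "\<And>i. i < k \<Longrightarrow> bounded_linear (L i)"
  shows "\<exists>f\<in>F. \<exists>g\<in>F. (\<forall>i<k. L i f = L i g) \<and> b < ennreal (norm (S f - S g))"
proof -
  define obs where "obs f = map (\<lambda>i. L i f) [0..<k]" for f
  define rep where "rep ys = (SOME g. g \<in> F \<and> obs g = ys)" for ys
  note \<open>b < e_det_non S F k\<close>
  also have "e_det_non S F k \<le> wc_error S F (\<lambda>f. S (rep (obs f)))"
    unfolding e_det_non_def obs_def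
    by (rule INF_lower2[where i = "(L, \<lambda>ys. S (rep ys))"]) (use L in auto)
  finally obtain f where f: "f \<in> F" "b < ennreal (norm (S f - S (rep (obs f))))"
    by (auto simp: wc_error_def less_SUP_iff)
  have rep: "rep (obs f) \<in> F \<and> obs (rep (obs f)) = obs f"
    unfolding rep_def by (rule someI[of _ f]) (use f in auto)
  then have "L i f = L i (rep (obs f))" if "i < k" for i
    using that by (auto simp: obs_def)
  with f rep show ?thesis by blast
qed

lemma triangular_difference_sequences:
  fixes S :: "'a::real_normed_vector \<Rightarrow> 'b::real_normed_vector" and \<xi> :: "'b \<Rightarrow> 'b \<Rightarrow> real"
  assumes S: "bounded_linear S" and \<xi>: "\<And>y. bounded_linear (\<xi> y)"
    and "\<And>k. k < N \<Longrightarrow> 0 \<le> b k \<and> ennreal (b k) < e_det_non S F k"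
  shows "\<exists>f g. \<forall>k<N. f k \<in> F \<and> g k \<in> F \<and> b k < norm (S (f k - g k))
    \<and> (\<forall>i<k. \<xi> (S (f i - g i)) (S (f k - g k)) = 0)"
  using assms(3)
proof (induction N)
  case (Suc N)
  then obtain f g where fg: "\<And>k. k < N \<Longrightarrow> f k \<in> F \<and> g k \<in> F \<and> b k < norm (S (f k - g k))
    \<and> (\<forall>i<k. \<xi> (S (f i - g i)) (S (f k - g k)) = 0)" by (metis less_Suc_eq)
  interpret S: bounded_linear S by (rule S)
  define L where "L i x = \<xi> (S (f i - g i)) (S x)" for i x
  have L: "bounded_linear (L i)" for i
    unfolding L_def by (rule bounded_linear_compose[OF \<xi> S])
  have b: "0 \<le> b N" "ennreal (b N) < e_det_non S F N" using Suc.prems[of N] by auto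
  obtain f' g' where f': "f' \<in> F" "g' \<in> F" "\<And>i. i < N \<Longrightarrow> L i f' = L i g'"
    "ennreal (b N) < ennreal (norm (S f' - S g'))"
    using e_det_non_witness[OF b(2), of L] L by blast
  have "b N < norm (S (f' - g'))" using f'(4) b(1) by (simp add: S.diff ennreal_less_iff)
  moreover have "\<xi> (S (f i - g i)) (S (f' - g')) = 0" if "i < N" for i
    using f'(3)[OF that] by (simp add: L_def S.diff linear_diff[OF bounded_linear.linear[OF \<xi>]])
  ultimately show ?case using fg f'(1,2)
    by (intro exI[of _ "f(N := f')"] exI[of _ "g(N := g')"]) (auto simp: less_Suc_eq)
qed simp

definition norming_system :: "nat \<Rightarrow> real \<Rightarrow> ('b::real_normed_vector \<Rightarrow> 'b \<Rightarrow> real) \<Rightarrow> bool" where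
  "norming_system N \<beta> \<xi> \<longleftrightarrow> (\<forall>y. bounded_linear (\<xi> y) \<and> \<xi> y y = norm y)
    \<and> (\<forall>w y. (\<forall>k<N. w k \<noteq> 0 \<and> (\<forall>i<k. \<xi> (w i) (w k) = 0)) \<longrightarrow> (\<Sum>k<N. (\<xi> (w k) y)\<^sup>2) \<le> \<beta>\<^sup>2 * (norm y)\<^sup>2)"

definition contains_difference_balls :: "nat \<Rightarrow> real \<Rightarrow> 'a::real_vector set \<Rightarrow> bool" where
  "contains_difference_balls N \<alpha> F \<longleftrightarrow> (\<forall>f g. (\<forall>k<N. f k \<in> F \<and> g k \<in> F) \<longrightarrow>
    (\<exists>c. \<forall>x. sumsq {..<N} x \<le> 1 \<longrightarrow> affine_chart {..<N} c (\<lambda>k. \<alpha> *\<^sub>R (f k - g k)) x \<in> F))"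

lemma prod_e_det_non_le_prod_e_ran:
  fixes S :: "'a::real_normed_vector \<Rightarrow> 'b::real_normed_vector" and \<xi> :: "'b \<Rightarrow> 'b \<Rightarrow> real"
  assumes S: "bounded_linear S" and "0 < \<alpha>" "0 < \<beta>"
    and \<xi>: "norming_system (2 * n) \<beta> \<xi>" and F: "contains_difference_balls (2 * n) \<alpha> F"
    and b: "\<And>k. k < 2 * n \<Longrightarrow> 0 < b k \<and> ennreal (b k) < e_det_non S F k"
  shows "ennreal (\<Prod>k<2 * n. b k) \<le> ennreal ((2 * \<beta> / \<alpha>) ^ (2 * n)) * (\<Prod>k<n. e_ran TYPE('c) S F k)\<^sup>2"
proof -
  interpret S: bounded_linear S by (rule S)
  have \<xi>_lin: "bounded_linear (\<xi> y)" and \<xi>_norm: "\<xi> y y = norm y" for y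
    using \<xi> by (simp_all add: norming_system_def)
  have "\<exists>f g. \<forall>k<2 * n. f k \<in> F \<and> g k \<in> F \<and> b k < norm (S (f k - g k))
      \<and> (\<forall>i<k. \<xi> (S (f i - g i)) (S (f k - g k)) = 0)"
    by (rule triangular_difference_sequences[OF S \<xi>_lin]) (use b in \<open>auto intro: less_imp_le\<close>)
  then obtain f g where fg: "\<And>k. k < 2 * n \<Longrightarrow> f k \<in> F \<and> g k \<in> F" "\<And>k. k < 2 * n \<Longrightarrow> b k < norm (S (f k - g k))"
    "\<And>i k. i < k \<Longrightarrow> k < 2 * n \<Longrightarrow> \<xi> (S (f i - g i)) (S (f k - g k)) = 0"
    by blast
  define w where "w k = S (f k - g k)" for k
  define a where "a k = \<alpha> *\<^sub>R (f k - g k)" for k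
  define \<eta> where "\<eta> i y = \<xi> (w i) y / \<alpha>" for i y
  obtain c where chart_in_F: "\<And>x. sumsq {..<2 * n} x \<le> 1 \<Longrightarrow> affine_chart {..<2 * n} c a x \<in> F"
    using F fg(1) unfolding contains_difference_balls_def a_def[abs_def] by blast
  have \<eta>_a: "\<eta> i (S (a k)) = \<xi> (w i) (w k)" for i k
    using \<open>0 < \<alpha>\<close> by (simp add: \<eta>_def a_def w_def S.scaleR linear_scale[OF bounded_linear.linear[OF \<xi>_lin]])
  have \<eta>_lin: "linear (\<eta> i)" for i
    by (intro linearI) (simp_all add: \<eta>_def add_divide_distrib linear_add[OF bounded_linear.linear[OF \<xi>_lin]]
        linear_scale[OF bounded_linear.linear[OF \<xi>_lin]])
  have "w k \<noteq> 0 \<and> (\<forall>i<k. \<xi> (w i) (w k) = 0)" if "k < 2 * n" for k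
    using fg(2,3) b that by (fastforce simp: w_def)
  then have "(\<Sum>k<2 * n. (\<xi> (w k) y)\<^sup>2) / \<alpha>\<^sup>2 \<le> \<beta>\<^sup>2 * (norm y)\<^sup>2 / \<alpha>\<^sup>2" for y
    using \<xi> by (intro divide_right_mono) (simp_all add: norming_system_def)
  then have bessel: "(\<Sum>k<2 * n. (\<eta> k y)\<^sup>2) \<le> (\<beta> / \<alpha>)\<^sup>2 * (norm y)\<^sup>2" for y
    by (simp add: \<eta>_def power_divide sum_divide_distrib)
  have "ennreal (\<Prod>k<2 * n. b k) \<le> ennreal (\<Prod>k<2 * n. \<eta> k (S (a k)))"
    using fg(2) b by (intro ennreal_leI prod_mono) (auto simp: \<eta>_a \<xi>_norm w_def less_imp_le)
  also have "\<dots> \<le> ennreal ((2 * (\<beta> / \<alpha>)) ^ (2 * n)) * (\<Prod>k<n. e_ran TYPE('c) S F k)\<^sup>2"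
    using fg(3) \<open>0 < \<alpha>\<close> \<open>0 < \<beta>\<close>
    by (intro triangular_diagonal_le_e_ran[OF S.linear_axioms \<eta>_lin bessel _ chart_in_F]) (auto simp: \<eta>_a w_def)
  finally show ?thesis by simp
qed

lemma ennreal_mult_le_of_real_below:
  fixes b e X :: ennreal
  assumes real_below: "\<And>r. 0 < r \<Longrightarrow> ennreal r < e \<Longrightarrow> b * ennreal r \<le> X"
  shows "b * e \<le> X"
proof -
  have "b * y \<le> X" if "y < e" for y
  proof (cases "y = 0")
    case False
    from \<open>y < e\<close> have "y \<noteq> \<top>" by auto
    then obtain r where "0 \<le> r" "y = ennreal r" by (cases y) auto
    then show ?thesis using real_below[of r] \<open>y \<noteq> 0\<close> \<open>y < e\<close> by (cases "r = 0") auto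
  qed simp
  then have "(SUP y\<in>{..<e}. b * y) \<le> X" by (intro SUP_least) auto
  moreover have "(SUP y\<in>{..<e}. b * y) = b * Sup {..<e}"
    using SUP_mult_left_ennreal[of b "\<lambda>y. y" "{..<e}"] by simp
  ultimately show ?thesis by (simp add: Sup_lessThan)
qed

lemma ennreal_prod_le_of_real_below:
  fixes e :: "'i \<Rightarrow> ennreal"
  assumes "finite K"
    and "\<And>b. (\<And>k. k \<in> K \<Longrightarrow> 0 < b k \<and> ennreal (b k) < e k) \<Longrightarrow> a * ennreal (\<Prod>k\<in>K. b k) \<le> X"
  shows "a * (\<Prod>k\<in>K. e k) \<le> X"
  using assms
proof (induction K arbitrary: a rule: finite_induct)
  case empty
  from empty[of "\<lambda>_. 0"] show ?case by simp
next
  case (insert i K)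
  have "(a * (\<Prod>k\<in>K. e k)) * e i \<le> X"
  proof (rule ennreal_mult_le_of_real_below)
    fix r :: real assume r: "0 < r" "ennreal r < e i"
    have "(a * ennreal r) * (\<Prod>k\<in>K. e k) \<le> X"
    proof (rule insert.IH)
      fix b assume b: "\<And>k. k \<in> K \<Longrightarrow> 0 < b k \<and> ennreal (b k) < e k"
      have "a * ennreal (\<Prod>k\<in>insert i K. (b(i := r)) k) \<le> X"
        using b r by (intro insert.prems) auto
      moreover have "(\<Prod>k\<in>insert i K. (b(i := r)) k) = r * (\<Prod>k\<in>K. b k)"
        using insert.hyps by (auto intro!: prod.cong)
      moreover have "0 \<le> (\<Prod>k\<in>K. b k)" using b by (intro prod_nonneg) (auto intro: less_imp_le)
      ultimately show "a * ennreal r * ennreal (\<Prod>k\<in>K. b k) \<le> X"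
        using r by (simp add: ennreal_mult mult.assoc)
    qed
    then show "a * (\<Prod>k\<in>K. e k) * ennreal r \<le> X" by (simp add: mult_ac)
  qed
  then show ?case using insert.hyps by (simp add: mult_ac)
qed

lemma eroot_le_eroot:
  assumes n: "n \<ge> 1" and C: "0 < C" and X_le: "X \<le> ennreal (C ^ (2 * n)) * Y\<^sup>2"
  shows "eroot (2 * n) X \<le> ennreal C * eroot n Y"
proof (cases Y)
  case top
  then show ?thesis using C by (simp add: eroot_def ennreal_mult_top)
next
  case y: (real y)
  have X: "X \<le> ennreal (C ^ (2 * n) * y\<^sup>2)"
    using X_le C y by (simp add: ennreal_power ennreal_mult)
  then obtain x where x: "0 \<le> x" "X = ennreal x" by (cases X) (auto simp: top_unique)
  have "root (2 * n) x \<le> root (2 * n) (C ^ (2 * n) * y\<^sup>2)"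
    using X x C y n by (simp add: ennreal_le_iff)
  also have "C ^ (2 * n) * y\<^sup>2 = (C * root n y) ^ (2 * n)"
    using n y by (simp add: power_mult_distrib power_mult[of "root n y" n 2] mult.commute[of 2])
  also have "root (2 * n) \<dots> = C * root n y"
    using n C y by (simp add: real_root_power_cancel)
  finally show ?thesis using x y C n by (simp add: eroot_def ennreal_mult[symmetric] ennreal_leI)
qed

theorem eroot_prod_e_det_non_le:
  fixes S :: "'a::real_normed_vector \<Rightarrow> 'b::real_normed_vector" and \<xi> :: "'b \<Rightarrow> 'b \<Rightarrow> real"
  assumes S: "bounded_linear S" and n: "n \<ge> 1" and "0 < \<alpha>" "0 < \<beta>"
    and \<xi>: "norming_system (2 * n) \<beta> \<xi>" and F: "contains_difference_balls (2 * n) \<alpha> F" and C: "2 * \<beta> / \<alpha> \<le> C"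
  shows "eroot (2 * n) (\<Prod>k<2 * n. e_det_non S F k) \<le> ennreal C * eroot n (\<Prod>k<n. e_ran TYPE('c) S F k)"
proof -
  have "1 * (\<Prod>k<2 * n. e_det_non S F k) \<le> ennreal ((2 * \<beta> / \<alpha>) ^ (2 * n)) * (\<Prod>k<n. e_ran TYPE('c) S F k)\<^sup>2"
  proof (rule ennreal_prod_le_of_real_below)
    fix b assume "\<And>k. k \<in> {..<2 * n} \<Longrightarrow> 0 < b k \<and> ennreal (b k) < e_det_non S F k"
    then show "1 * ennreal (\<Prod>k<2 * n. b k) \<le> ennreal ((2 * \<beta> / \<alpha>) ^ (2 * n)) * (\<Prod>k<n. e_ran TYPE('c) S F k)\<^sup>2"
      using prod_e_det_non_le_prod_e_ran[OF S \<open>0 < \<alpha>\<close> \<open>0 < \<beta>\<close> \<xi> F, of b] by simp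
  qed simp
  then have "eroot (2 * n) (\<Prod>k<2 * n. e_det_non S F k)
      \<le> ennreal (2 * \<beta> / \<alpha>) * eroot n (\<Prod>k<n. e_ran TYPE('c) S F k)"
    using \<open>0 < \<alpha>\<close> \<open>0 < \<beta>\<close> by (intro eroot_le_eroot[OF n]) simp_all
  also have "\<dots> \<le> ennreal C * eroot n (\<Prod>k<n. e_ran TYPE('c) S F k)"
    using C by (intro mult_right_mono ennreal_leI) simp_all
  finally show ?thesis .
qed

lemma norming_system_exists: "\<exists>\<xi> :: 'b::real_normed_vector \<Rightarrow> 'b \<Rightarrow> real. norming_system N (sqrt N) \<xi>"
proof -
  obtain \<xi> :: "'b \<Rightarrow> 'b \<Rightarrow> real" where \<xi>: "\<And>y. bounded_linear (\<xi> y)" "\<And>y x. \<bar>\<xi> y x\<bar> \<le> norm x" "\<And>y. \<xi> y y = norm y"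
    using norming_functional_exists by metis
  have "(\<Sum>k<N. (\<xi> (w k) y)\<^sup>2) \<le> (sqrt N)\<^sup>2 * (norm y)\<^sup>2" for w y
  proof -
    have "(\<Sum>k<N. (\<xi> (w k) y)\<^sup>2) \<le> (\<Sum>k<N. (norm y)\<^sup>2)"
      using \<xi>(2) by (intro sum_mono) (simp flip: abs_le_square_iff)
    then show ?thesis by simp
  qed
  with \<xi> show ?thesis unfolding norming_system_def by blast
qed

lemma bessel_inequality:
  fixes ip :: "'b::real_vector \<Rightarrow> 'b \<Rightarrow> real"
  assumes sym: "\<And>x y. ip x y = ip y x" and lin: "\<And>x. linear (ip x)" and nonneg: "\<And>x. 0 \<le> ip x x"
    and "finite A" and orth: "\<And>i j. i \<in> A \<Longrightarrow> j \<in> A \<Longrightarrow> i \<noteq> j \<Longrightarrow> ip (w i) (w j) = 0"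
    and nonzero: "\<And>i. i \<in> A \<Longrightarrow> ip (w i) (w i) \<noteq> 0"
  shows "(\<Sum>i\<in>A. (ip (w i) y)\<^sup>2 / ip (w i) (w i)) \<le> ip y y"
proof -
  define t where "t i = ip (w i) y / ip (w i) (w i)" for i
  define p where "p = (\<Sum>i\<in>A. t i *\<^sub>R w i)"
  have ip_p: "ip z p = (\<Sum>i\<in>A. t i * ip z (w i))" for z
    by (simp add: p_def linear_sum[OF lin] linear_scale[OF lin])
  have "ip (w j) p = (\<Sum>i\<in>A. if j = i then ip (w i) y else 0)" if "j \<in> A" for j
    unfolding ip_p using orth nonzero that by (intro sum.cong) (auto simp: t_def)
  then have "ip p (w j) = ip (w j) y" if "j \<in> A" for j
    using \<open>finite A\<close> that by (simp add: sym[of p])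
  then have "ip p p = (\<Sum>i\<in>A. t i * ip (w i) y)" by (simp add: ip_p)
  moreover have "ip y p = (\<Sum>i\<in>A. t i * ip (w i) y)" by (simp add: ip_p sym[of y])
  moreover have "ip (y - p) (y - p) = ip y y - 2 * ip y p + ip p p"
    by (simp add: linear_diff[OF lin] sym[of "y - p"] sym[of p y])
  ultimately have "(\<Sum>i\<in>A. t i * ip (w i) y) \<le> ip y y" using nonneg[of "y - p"] by simp
  then show ?thesis by (simp add: t_def power2_eq_square)
qed

lemma hilbert_norming_system_exists:
  assumes "hilbert_norm TYPE('b::real_normed_vector)"
  shows "\<exists>\<xi> :: 'b \<Rightarrow> 'b \<Rightarrow> real. norming_system N 1 \<xi>"
proof -
  obtain ip :: "'b \<Rightarrow> 'b \<Rightarrow> real" where sym: "\<And>x y. ip x y = ip y x" and lin: "\<And>x. linear (ip x)"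
    and norm: "\<And>x. norm x = sqrt (ip x x)" using assms unfolding hilbert_norm_def by blast
  have nonneg: "0 \<le> ip x x" for x using norm[of x] norm_ge_zero[of x] by simp
  have square: "ip x x = (norm x)\<^sup>2" for x unfolding norm using nonneg by simp
  define \<xi> where "\<xi> y z = ip y z / norm y" for y z
  have bessel: "(\<Sum>k\<in>A. (\<xi> (w k) y)\<^sup>2) \<le> (norm y)\<^sup>2"
    if "finite A" and nonzero: "\<And>k. k \<in> A \<Longrightarrow> w k \<noteq> 0"
      and orth: "\<And>i k. i \<in> A \<Longrightarrow> k \<in> A \<Longrightarrow> i < k \<Longrightarrow> \<xi> (w i) (w k) = 0"
    for A :: "nat set" and w y
  proof -
    have "ip (w i) (w k) = 0" if "i \<in> A" "k \<in> A" "i < k" for i k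
      using orth[OF that] nonzero[OF that(1)] by (simp add: \<xi>_def)
    then have "ip (w i) (w k) = 0" if "i \<in> A" "k \<in> A" "i \<noteq> k" for i k
      using that sym by (metis linorder_neqE_nat)
    from bessel_inequality[OF sym lin nonneg \<open>finite A\<close> this, where y = y] nonzero show ?thesis
      by (simp add: \<xi>_def square power_divide)
  qed
  have "bounded_linear (\<xi> y)" for y
  proof (rule bounded_linear_intro[where K = 1])
    show "\<xi> y (a + b) = \<xi> y a + \<xi> y b" for a b
      by (simp add: \<xi>_def linear_add[OF lin] add_divide_distrib)
    show "\<xi> y (c *\<^sub>R a) = c *\<^sub>R \<xi> y a" for c a
      by (simp add: \<xi>_def linear_scale[OF lin])
    show "norm (\<xi> y a) \<le> norm a * 1" for a
      using bessel[of "{0}" "\<lambda>_. y" a] by (cases "y = 0") (simp_all add: \<xi>_def flip: abs_le_square_iff)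
  qed
  moreover have "\<xi> y y = norm y" for y by (simp add: \<xi>_def square power2_eq_square)
  ultimately show ?thesis
    using bessel[of "{..<N}"] unfolding norming_system_def by (intro exI[of _ \<xi>]) auto
qed

lemma convex_contains_difference_balls:
  assumes F: "convex F" and N: "N \<ge> 1"
  shows "contains_difference_balls N (1 / (2 * real N)) F"
  unfolding contains_difference_balls_def
proof (intro allI impI exI)
  fix f g :: "nat \<Rightarrow> 'a" and x :: "nat \<Rightarrow> real"
  assume fg: "\<forall>k<N. f k \<in> F \<and> g k \<in> F" and x: "sumsq {..<N} x \<le> 1"
  define m where "m k = (1 / (2 * real N)) *\<^sub>R (f k + g k)" for k
  define d where "d k = (1 / (2 * real N)) *\<^sub>R (f k - g k)" for k
  define y where "y k = ((1 + x k) / 2) *\<^sub>R f k + ((1 - x k) / 2) *\<^sub>R g k" for k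
  have y: "y k \<in> F" if "k < N" for k
  proof -
    have "(x k)\<^sup>2 \<le> sumsq {..<N} x" unfolding sumsq_def using that by (intro member_le_sum) auto
    then have "\<bar>x k\<bar> \<le> 1" using x by (simp flip: abs_square_le_1)
    then show ?thesis
      unfolding y_def using fg that by (intro convexD[OF F]) (auto simp: field_simps)
  qed
  have "(1 / real N) *\<^sub>R y k = m k + x k *\<^sub>R d k" for k
    by (simp add: y_def m_def d_def scaleR_add_right scaleR_diff_right scaleR_add_left scaleR_diff_left
        add_divide_distrib diff_divide_distrib mult.commute)
  then have "affine_chart {..<N} (\<Sum>k<N. m k) d x = (\<Sum>k<N. (1 / real N) *\<^sub>R y k)"
    by (simp add: affine_chart_def sum.distrib)
  also have "\<dots> \<in> F" using N by (intro convex_sum[OF _ F]) (auto simp: y)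
  finally show "affine_chart {..<N} (\<Sum>k<N. (1 / (2 * real N)) *\<^sub>R (f k + g k))
      (\<lambda>k. (1 / (2 * real N)) *\<^sub>R (f k - g k)) x \<in> F"
    by (simp add: m_def d_def[abs_def])
qed

lemma symmetric_convex_sum:
  assumes F: "convex F" "symmetric_set F" "F \<noteq> {}"
    and A: "finite A" "\<And>k. k \<in> A \<Longrightarrow> y k \<in> F" "(\<Sum>k\<in>A. \<bar>t k\<bar>) \<le> 1"
  shows "(\<Sum>k\<in>A. t k *\<^sub>R y k) \<in> F"
proof -
  have neg: "- z \<in> F" if "z \<in> F" for z using F(2) that by (simp add: symmetric_set_def)
  obtain z where z: "z \<in> F" using F(3) by blast
  have zero: "0 \<in> F" using convexD[OF F(1) z neg[OF z], of "1/2" "1/2"] by simp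
  define r where "r = (\<Sum>k\<in>A. \<bar>t k\<bar>)"
  show ?thesis
  proof (cases "r = 0")
    case True
    then have "\<forall>k\<in>A. t k = 0" using A(1) by (simp add: r_def sum_nonneg_eq_0_iff)
    then show ?thesis using zero by simp
  next
    case False
    moreover have "0 \<le> r" unfolding r_def by (rule sum_nonneg) simp
    ultimately have "0 < r" by simp
    have "(\<Sum>k\<in>A. (\<bar>t k\<bar> / r) *\<^sub>R (sgn (t k) *\<^sub>R y k)) \<in> F"
    proof (rule convex_sum[OF A(1) F(1)])
      show "(\<Sum>k\<in>A. \<bar>t k\<bar> / r) = 1" using \<open>0 < r\<close> by (simp add: r_def flip: sum_divide_distrib)
      show "sgn (t k) *\<^sub>R y k \<in> F" if "k \<in> A" for k
        using A(2)[OF that] neg zero by (simp add: sgn_real_def)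
    qed (use \<open>0 < r\<close> in simp)
    from convexD[OF F(1) this zero, of r "1 - r"] show ?thesis
      using \<open>0 < r\<close> A(3) by (simp add: scaleR_sum_right abs_mult_sgn flip: r_def)
  qed
qed

lemma symmetric_contains_difference_balls:
  assumes F: "convex F" "symmetric_set F" and N: "N \<ge> 1"
  shows "contains_difference_balls N (1 / (2 * sqrt N)) F"
  unfolding contains_difference_balls_def
proof (intro allI impI exI)
  fix f g :: "nat \<Rightarrow> 'a" and x :: "nat \<Rightarrow> real"
  assume fg: "\<forall>k<N. f k \<in> F \<and> g k \<in> F" and x: "sumsq {..<N} x \<le> 1"
  have "F \<noteq> {}" using fg N by force
  moreover have "(1/2) *\<^sub>R (f k - g k) \<in> F" if "k < N" for k
    using convexD[OF F(1), of "f k" "- g k" "1/2" "1/2"] fg F(2) that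
    by (simp add: symmetric_set_def scaleR_diff_right)
  moreover have "(\<Sum>k<N. \<bar>x k / sqrt N\<bar>) \<le> 1"
  proof -
    have "(\<Sum>k<N. \<bar>x k\<bar>)\<^sup>2 \<le> (\<Sum>k<N. \<bar>x k\<bar>\<^sup>2) * card {..<N}"
      by (rule sum_squared_le_sum_of_squares)
    also have "\<dots> \<le> N" using mult_right_mono[OF x, of "real N"] by (simp add: sumsq_def)
    finally have "(\<Sum>k<N. \<bar>x k\<bar>) \<le> sqrt N" by (rule real_le_rsqrt)
    then show ?thesis using N by (simp flip: sum_divide_distrib)
  qed
  ultimately have "(\<Sum>k<N. (x k / sqrt N) *\<^sub>R ((1/2) *\<^sub>R (f k - g k))) \<in> F"
    using F by (intro symmetric_convex_sum) auto
  then show "affine_chart {..<N} 0 (\<lambda>k. (1 / (2 * sqrt N)) *\<^sub>R (f k - g k)) x \<in> F"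
    by (simp add: affine_chart_def mult.commute)
qed

lemma comparison_constants:
  fixes n :: nat
  assumes "n \<ge> 1"
  shows "2 * sqrt (2 * n) / (1 / (2 * real (2 * n))) \<le> 2 powr (7/2) * real n powr (3/2)"
    and "2 * sqrt (2 * n) / (1 / (2 * sqrt (2 * n))) \<le> 2 powr (7/2) * real n"
    and "2 * 1 / (1 / (2 * real (2 * n))) \<le> 2 powr (7/2) * real n"
    and "2 * 1 / (1 / (2 * sqrt (2 * n))) \<le> 2 powr (7/2) * real n powr (1/2)"
proof -
  have "2 powr (7/2) = 8 * sqrt (2::real)"
    using powr_add[of 2 3 "1/2::real"] by (simp add: powr_half_sqrt)
  moreover have "real n powr (3/2) = n * sqrt n"
    using powr_add[of "real n" 1 "1/2"] by (simp add: powr_half_sqrt)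
  moreover have "real n powr (1/2) = sqrt n" by (simp add: powr_half_sqrt)
  ultimately show "2 * sqrt (2 * n) / (1 / (2 * real (2 * n))) \<le> 2 powr (7/2) * real n powr (3/2)"
    "2 * sqrt (2 * n) / (1 / (2 * sqrt (2 * n))) \<le> 2 powr (7/2) * real n"
    "2 * 1 / (1 / (2 * real (2 * n))) \<le> 2 powr (7/2) * real n"
    "2 * 1 / (1 / (2 * sqrt (2 * n))) \<le> 2 powr (7/2) * real n powr (1/2)"
    using assms by (simp_all add: real_sqrt_mult field_simps)
qed

theorem theorem5p1:
  fixes S :: "'a::banach \<Rightarrow> 'b::banach" and F :: "'a set" and n :: nat
  assumes "bounded_linear S" and "convex F" and "n \<ge> 1"
  shows "eroot (2*n) (\<Prod>k<2*n. e_det_non S F k)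
           \<le> ennreal (2 powr (7/2) * real n powr (3/2)) * eroot n (\<Prod>k<n. e_ran TYPE('c) S F k)
       \<and> (symmetric_set F \<or> hilbert_norm TYPE('b) \<longrightarrow>
         eroot (2*n) (\<Prod>k<2*n. e_det_non S F k)
           \<le> ennreal (2 powr (7/2) * real n) * eroot n (\<Prod>k<n. e_ran TYPE('c) S F k))
       \<and> (symmetric_set F \<and> hilbert_norm TYPE('b) \<longrightarrow>
         eroot (2*n) (\<Prod>k<2*n. e_det_non S F k)
           \<le> ennreal (2 powr (7/2) * real n powr (1/2)) * eroot n (\<Prod>k<n. e_ran TYPE('c) S F k))"
proof -
  let ?bound = "\<lambda>C. eroot (2 * n) (\<Prod>k<2 * n. e_det_non S F k)
    \<le> ennreal C * eroot n (\<Prod>k<n. e_ran TYPE('c) S F k)"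
  have "1 \<le> 2 * n" using \<open>n \<ge> 1\<close> by simp
  note compare = eroot_prod_e_det_non_le[OF \<open>bounded_linear S\<close> \<open>n \<ge> 1\<close>]
    and constants = comparison_constants[OF \<open>n \<ge> 1\<close>]
    and convex_balls = convex_contains_difference_balls[OF \<open>convex F\<close> \<open>1 \<le> 2 * n\<close>]
    and symmetric_balls = symmetric_contains_difference_balls[OF \<open>convex F\<close> _ \<open>1 \<le> 2 * n\<close>]
  have banach: "?bound C"
    if "0 < \<alpha>" "contains_difference_balls (2 * n) \<alpha> F" "2 * sqrt (2 * n) / \<alpha> \<le> C" for \<alpha> C
    using norming_system_exists[of "2 * n", where 'b = 'b] compare[of \<alpha> "sqrt (2 * n)"] that \<open>n \<ge> 1\<close> by auto
  have hilbert: "?bound C"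
    if "hilbert_norm TYPE('b)" "0 < \<alpha>" "contains_difference_balls (2 * n) \<alpha> F" "2 * 1 / \<alpha> \<le> C" for \<alpha> C
    using hilbert_norming_system_exists[OF that(1), of "2 * n"] compare[of \<alpha> 1] that by auto
  have "?bound (2 powr (7/2) * real n powr (3/2))"
    using \<open>n \<ge> 1\<close> by (intro banach[OF _ convex_balls constants(1)]) simp
  moreover have "?bound (2 powr (7/2) * real n)" if "symmetric_set F"
    using \<open>n \<ge> 1\<close> by (intro banach[OF _ symmetric_balls[OF that] constants(2)]) simp
  moreover have "?bound (2 powr (7/2) * real n)" if "hilbert_norm TYPE('b)"
    using \<open>n \<ge> 1\<close> by (intro hilbert[OF that _ convex_balls constants(3)]) simp
  moreover have "?bound (2 powr (7/2) * real n powr (1/2))" if "symmetric_set F" "hilbert_norm TYPE('b)"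
    using \<open>n \<ge> 1\<close> by (intro hilbert[OF that(2) _ symmetric_balls[OF that(1)] constants(4)]) simp
  ultimately show ?thesis by blast
qed

end
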